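(* Let $H$ be a separable (infinite-dimensional, complex) Hilbert space, let $\{e_n\}_{n=1}^{\infty}$ be a Riesz basis of $H$, let $k\in\mathbb{N}$ and let $\{f(n)\}_{n=1}^{\infty}\in\mathcal{S}_k$. Then the operator $A_k:H_k(\{e_n\})\supset D(A_k)\to H_k(\{e_n\})$ defined by $$A_k\,(\mathfrak{f})\sum_{n=1}^{\infty}c_ne_n=(\mathfrak{f})\sum_{n=1}^{\infty}i f(n)\, c_ne_n,$$ $$D(A_k)=\Bigl\{x=(\mathfrak{f})\sum_{n=1}^{\infty}c_ne_n\in H_k(\{e_n\}):\ \{f(n)c_n\}_{n=1}^{\infty}\in\ell_2(\Delta^k)\Bigr\},$$ generates a $C_0$-group $\{e^{A_kt}\}_{t\in\mathbb{R}}$ on $H_k(\{e_n\})$, which acts for every $t\in\mathbb{R}$ by the formula $$e^{A_kt}\,(\mathfrak{f})\sum_{n=1}^{\infty}c_ne_n=(\mathfrak{f})\sum_{n=1}^{\infty}e^{itf(n)}c_ne_n .$$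
   Context: For a sequence $\{u_n\}_{n=1}^\infty$ put $u_{m}=0$ for all integers $m\le 0$ and $\Delta^k u_n=\sum_{j=0}^k(-1)^j\binom{k}{j}u_{n-j}$, $n\ge1$. The class $\mathcal{S}_k$ consists of all real sequences $\{f(n)\}_{n=1}^\infty$ such that $\lim_{n\to\infty}f(n)=+\infty$ and $\{n^j\Delta^jf(n)\}_{n=1}^\infty\in\ell_\infty$ for every $1\le j\le k$. $\ell_2(\Delta^k)$ is the set of complex sequences $\{c_n\}_{n=1}^\infty$ with $\{\Delta^kc_n\}_{n=1}^\infty\in\ell_2$. $(\mathfrak{f})\sum_{n=1}^\infty c_ne_n$ denotes a formal series, i.e. it is identified with its coefficient sequence (no convergence is required). For a Riesz basis $\{e_n\}$ of $H$ (the image of an orthonormal basis under a bounded, boundedly invertible operator), $H_k(\{e_n\})$ is the space of formal series $x=(\mathfrak{f})\sum_{n=1}^\infty c_ne_n$ with $\{c_n\}\in\ell_2(\Delta^k)$, with coefficientwise linear operations and norm $\|x\|_k=\bigl\|\sum_{n=1}^\infty(\Delta^kc_n)e_n\bigr\|$, where $\|\cdot\|$ is the norm of $H$. It is a Hilbert space; equivalently, it is the completion of $H$ in the norm $\|(I-T)^kx\|$, where $T\in B(H)$ is the right shift $Te_n=e_{n+1}$. *)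

theory Defs
  imports "HOL-Analysis.Analysis" "HOL-Library.Function_Algebras"
begin

section \<open>Complex vector spaces and complex Hilbert spaces\<close>

class complex_vector = ab_group_add +
  fixes scaleC :: "complex \<Rightarrow> 'a \<Rightarrow> 'a"  (infixr \<open>*\<^sub>C\<close> 75)
  assumes scaleC_add_right: "a *\<^sub>C (x + y) = a *\<^sub>C x + a *\<^sub>C y"
    and scaleC_add_left: "(a + b) *\<^sub>C x = a *\<^sub>C x + b *\<^sub>C x"
    and scaleC_scaleC: "a *\<^sub>C b *\<^sub>C x = (a * b) *\<^sub>C x"
    and scaleC_one: "1 *\<^sub>C x = x"

global_interpretation complex_vector:
  vector_space "scaleC :: complex \<Rightarrow> 'a \<Rightarrow> 'a::complex_vector"
  defines cspan = "complex_vector.span"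
    and csubspace = "complex_vector.subspace"
  by unfold_locales (fact scaleC_add_right scaleC_add_left scaleC_scaleC scaleC_one)+

instantiation complex :: complex_vector
begin
definition scaleC_complex :: "complex \<Rightarrow> complex \<Rightarrow> complex"
  where "scaleC_complex a x = a * x"
instance by standard (simp_all add: scaleC_complex_def algebra_simps)
end

instantiation "fun" :: (type, complex_vector) complex_vector
begin
definition scaleC_fun :: "complex \<Rightarrow> ('a \<Rightarrow> 'b) \<Rightarrow> ('a \<Rightarrow> 'b)"
  where "scaleC_fun a c = (\<lambda>n. a *\<^sub>C c n)"
instance
  by standard (simp_all add: scaleC_fun_def fun_eq_iff scaleC_add_right scaleC_add_left
      scaleC_scaleC scaleC_one)
end

text \<open>
  The norm, metric and topology are those of the underlying real inner product space; the real
  inner product is the real part of the complex one, so that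
  \<open>norm x ^ 2 = Re (cinner x x) = cinner x x\<close>.
\<close>

class complex_inner = complex_vector + real_inner +
  fixes cinner :: "'a \<Rightarrow> 'a \<Rightarrow> complex"
  assumes scaleR_scaleC: "r *\<^sub>R x = complex_of_real r *\<^sub>C x"
    and cinner_commute: "cinner x y = cnj (cinner y x)"
    and cinner_add_left: "cinner (x + y) z = cinner x z + cinner y z"
    and cinner_scaleC_left: "cinner (a *\<^sub>C x) y = a * cinner x y"
    and inner_eq_Re_cinner: "x \<bullet> y = Re (cinner x y)"

class complex_hilbert = complex_inner + complete_space


section \<open>Riesz bases\<close>

text \<open>
  Sequences indexed by \<open>1, 2, 3, \<dots>\<close> are functions on \<^typ>\<open>nat\<close> whose value at \<open>0\<close> is not part of
  the data: for \<open>e\<close> and \<open>f\<close> it is ignored, and for coefficient sequences it is fixed to be \<open>0\<close>.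
\<close>

definition orthonormal_basis :: "(nat \<Rightarrow> 'h::complex_hilbert) \<Rightarrow> bool" where
  "orthonormal_basis u \<longleftrightarrow>
     (\<forall>m\<ge>1. \<forall>n\<ge>1. cinner (u m) (u n) = (if m = n then 1 else 0)) \<and>
     closure (cspan (u ` {1..})) = UNIV"

definition bounded_clinear :: "('h::complex_hilbert \<Rightarrow> 'h) \<Rightarrow> bool" where
  "bounded_clinear S \<longleftrightarrow> bounded_linear S \<and> (\<forall>a x. S (a *\<^sub>C x) = a *\<^sub>C S x)"

definition riesz_basis :: "(nat \<Rightarrow> 'h::complex_hilbert) \<Rightarrow> bool" where
  "riesz_basis e \<longleftrightarrow>
     (\<exists>u S. orthonormal_basis u \<and> bounded_clinear S \<and> bij S \<and> bounded_clinear (inv S) \<and>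
            (\<forall>n\<ge>1. e n = S (u n)))"


section \<open>Differences, the class \<open>\<S>\<^sub>k\<close>, and the space \<open>H\<^sub>k\<close>\<close>

text \<open>The guard \<open>j < n\<close> implements the convention \<open>u m = 0\<close> for all integers \<open>m \<le> 0\<close>.\<close>

definition bdiff :: "nat \<Rightarrow> (nat \<Rightarrow> 'a::comm_ring_1) \<Rightarrow> nat \<Rightarrow> 'a" where
  "bdiff k u n = (\<Sum>j\<le>k. (- 1) ^ j * of_nat (k choose j) * (if j < n then u (n - j) else 0))"

definition S_class :: "nat \<Rightarrow> (nat \<Rightarrow> real) set" where
  "S_class k = {f. filterlim f at_top sequentially \<and>
                   (\<forall>j\<in>{1..k}. Bseq (\<lambda>n. real n ^ j * bdiff j f n))}"

definition l2_Delta :: "nat \<Rightarrow> (nat \<Rightarrow> complex) set" where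
  "l2_Delta k = {c. c 0 = 0 \<and> summable (\<lambda>n. (cmod (bdiff k c n))\<^sup>2)}"

text \<open>
  A formal series is identified with its coefficient sequence, so the underlying vector space of
  \<open>H\<^sub>k({e\<^sub>n})\<close> is \<^const>\<open>l2_Delta\<close>, with the pointwise operations of \<^typ>\<open>nat \<Rightarrow> complex\<close>; the
  basis enters through the norm.
\<close>

definition Hk_norm :: "nat \<Rightarrow> (nat \<Rightarrow> 'h::complex_hilbert) \<Rightarrow> (nat \<Rightarrow> complex) \<Rightarrow> real" where
  "Hk_norm k e c = norm (\<Sum>n. bdiff k c (Suc n) *\<^sub>C e (Suc n))"


section \<open>\<open>C\<^sub>0\<close>-groups and their generators on a Banach space given by a carrier and a norm\<close>

definition complex_banach_on :: "'v::complex_vector set \<Rightarrow> ('v \<Rightarrow> real) \<Rightarrow> bool" where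
  "complex_banach_on X N \<longleftrightarrow>
     csubspace X \<and>
     (\<forall>x\<in>X. N x \<ge> 0 \<and> (N x = 0 \<longleftrightarrow> x = 0)) \<and>
     (\<forall>a. \<forall>x\<in>X. N (a *\<^sub>C x) = cmod a * N x) \<and>
     (\<forall>x\<in>X. \<forall>y\<in>X. N (x + y) \<le> N x + N y) \<and>
     (\<forall>s::nat \<Rightarrow> 'v. range s \<subseteq> X \<and> (\<forall>\<epsilon>>0. \<exists>M. \<forall>m\<ge>M. \<forall>n\<ge>M. N (s m - s n) < \<epsilon>) \<longrightarrow>
        (\<exists>x\<in>X. (\<lambda>n. N (s n - x)) \<longlonglongrightarrow> 0))"

definition bounded_operator_on ::
  "'v::complex_vector set \<Rightarrow> ('v \<Rightarrow> real) \<Rightarrow> ('v \<Rightarrow> 'v) \<Rightarrow> bool" where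
  "bounded_operator_on X N T \<longleftrightarrow>
     T ` X \<subseteq> X \<and>
     (\<forall>x\<in>X. \<forall>y\<in>X. T (x + y) = T x + T y) \<and>
     (\<forall>a. \<forall>x\<in>X. T (a *\<^sub>C x) = a *\<^sub>C T x) \<and>
     (\<exists>C. \<forall>x\<in>X. N (T x) \<le> C * N x)"

definition C0_group_on ::
  "'v::complex_vector set \<Rightarrow> ('v \<Rightarrow> real) \<Rightarrow> (real \<Rightarrow> 'v \<Rightarrow> 'v) \<Rightarrow> bool" where
  "C0_group_on X N U \<longleftrightarrow>
     complex_banach_on X N \<and>
     (\<forall>t. bounded_operator_on X N (U t)) \<and>
     (\<forall>x\<in>X. U 0 x = x) \<and>
     (\<forall>s t. \<forall>x\<in>X. U (s + t) x = U s (U t x)) \<and>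
     (\<forall>x\<in>X. \<forall>t\<^sub>0. ((\<lambda>t. N (U t x - U t\<^sub>0 x)) \<longlongrightarrow> 0) (at t\<^sub>0))"

definition has_orbit_derivative ::
  "('v::complex_vector \<Rightarrow> real) \<Rightarrow> (real \<Rightarrow> 'v \<Rightarrow> 'v) \<Rightarrow> 'v \<Rightarrow> 'v \<Rightarrow> bool" where
  "has_orbit_derivative N U x y \<longleftrightarrow>
     ((\<lambda>t. N (complex_of_real (1 / t) *\<^sub>C (U t x - x) - y)) \<longlongrightarrow> 0) (at 0)"

text \<open>
  The operator \<open>A\<close> with domain \<open>D\<close> is the infinitesimal generator of \<open>U\<close>, including equality of
  domains; values of \<open>A\<close> outside \<open>D\<close> are irrelevant.
\<close>

definition generates_C0_group_on ::
  "'v::complex_vector set \<Rightarrow> ('v \<Rightarrow> real) \<Rightarrow> 'v set \<Rightarrow> ('v \<Rightarrow> 'v) \<Rightarrow> (real \<Rightarrow> 'v \<Rightarrow> 'v) \<Rightarrow> bool" where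
  "generates_C0_group_on X N D A U \<longleftrightarrow>
     C0_group_on X N U \<and>
     D = {x \<in> X. \<exists>y\<in>X. has_orbit_derivative N U x y} \<and>
     (\<forall>x\<in>D. A x \<in> X \<and> has_orbit_derivative N U x (A x))"


section \<open>The operator \<open>A\<^sub>k\<close>\<close>

definition A_op :: "(nat \<Rightarrow> real) \<Rightarrow> (nat \<Rightarrow> complex) \<Rightarrow> nat \<Rightarrow> complex" where
  "A_op f c = (\<lambda>n. \<i> * complex_of_real (f n) * c n)"

definition A_dom :: "nat \<Rightarrow> (nat \<Rightarrow> real) \<Rightarrow> (nat \<Rightarrow> complex) set" where
  "A_dom k f = {c \<in> l2_Delta k. (\<lambda>n. complex_of_real (f n) * c n) \<in> l2_Delta k}"

end

theory Submission
  imports Defs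
begin

text \<open>
  The Riesz basis makes \<^term>\<open>Hk_norm k e c\<close> equivalent to the \<open>\<ell>\<^sub>2\<close> norm of \<open>\<Delta>\<^sup>k c\<close>, so everything
  reduces to multipliers \<open>a\<close> of \<open>\<ell>\<^sub>2(\<Delta>\<^sup>k)\<close>. If \<open>n\<^sup>j \<Delta>\<^sup>j a\<close> is bounded for all \<open>j \<le> k\<close>, then \<open>a\<close> is a
  bounded multiplier: the Leibniz rule distributes \<open>\<Delta>\<^sup>k\<close>, and Hardy's inequality absorbs each
  weight \<open>1 / n\<close> at the cost of one more difference of \<open>c\<close>. If a family of such multipliers is uniformly bounded
  in this sense and tends to \<open>0\<close> pointwise, it tends to \<open>0\<close> strongly, by dominated convergence.
  The mean value theorem along the interpolation \<open>g n + s (g (n + 1) - g n)\<close>, \<open>0 \<le> s \<le> 1\<close>, shows by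
  induction on \<open>k\<close> that \<open>a n = exp (i t f n)\<close> satisfies these bounds, uniformly for \<open>t\<close> in bounded
  sets; a second mean value argument, now in \<open>t\<close>, gives them for the difference quotients that
  determine the generator.
\<close>

section \<open>Square-summable sequences and Hardy's inequality\<close>

definition l2 :: "(nat \<Rightarrow> complex) \<Rightarrow> bool" where
  "l2 x \<longleftrightarrow> summable (\<lambda>n. (cmod (x n))\<^sup>2)"

text \<open>For a sequence outside \<open>l2\<close> the infinite sum has an unspecified value, so
  \<open>l2\<close> accompanies every norm estimate.\<close>

definition l2norm :: "(nat \<Rightarrow> complex) \<Rightarrow> real" where
  "l2norm x = sqrt (\<Sum>n. (cmod (x n))\<^sup>2)"

lemma l2norm_nonneg [simp]: "l2norm x \<ge> 0" if "l2 x"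
  using that by (auto simp: l2norm_def l2_def intro!: suminf_nonneg)

lemma L2_set_le_l2norm: "L2_set (\<lambda>n. cmod (x n)) {..<N} \<le> l2norm x" if "l2 x"
  unfolding L2_set_def l2norm_def using that
  by (auto simp: l2_def intro!: sum_le_suminf)

text \<open>A uniform bound on finite sections gives membership and norm bound together, so most
  estimates below reduce to finite sums.\<close>

lemma l2_boundI:
  assumes "\<And>N. L2_set (\<lambda>n. cmod (x n)) {..<N} \<le> K"
  shows "l2 x" "l2norm x \<le> K"
proof -
  have K: "K \<ge> 0" using assms[of 0] by simp
  have le: "(\<Sum>n<N. (cmod (x n))\<^sup>2) \<le> K\<^sup>2" for N
    using assms[of N] K unfolding L2_set_def by (meson real_sqrt_le_iff real_le_lsqrt real_sqrt_le_mono sqrt_le_D)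
  show s: "l2 x"
    unfolding l2_def by (rule summableI_nonneg_bounded[where x="K\<^sup>2"]) (use le in auto)
  have "(\<Sum>n. (cmod (x n))\<^sup>2) \<le> K\<^sup>2"
    using s le unfolding l2_def by (intro suminf_le_const) auto
  thus "l2norm x \<le> K" unfolding l2norm_def using K by (simp add: real_le_lsqrt)
qed

lemma cmod_le_l2norm: "cmod (x n) \<le> l2norm x" if "l2 x"
proof -
  have "cmod (x n) \<le> L2_set (\<lambda>n. cmod (x n)) {..<Suc n}"
    by (rule member_le_L2_set) auto
  thus ?thesis using L2_set_le_l2norm[OF that] by (meson order_trans)
qed

lemma l2norm_dominated:
  assumes "l2 y" "\<And>n. cmod (x n) \<le> K * cmod (y n)" "K \<ge> 0"
  shows "l2 x" "l2norm x \<le> K * l2norm y"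
proof -
  have "L2_set (\<lambda>n. cmod (x n)) {..<N} \<le> K * l2norm y" for N
  proof -
    have "L2_set (\<lambda>n. cmod (x n)) {..<N} \<le> L2_set (\<lambda>n. K * cmod (y n)) {..<N}"
      by (intro L2_set_mono) (use assms in auto)
    also have "\<dots> = K * L2_set (\<lambda>n. cmod (y n)) {..<N}"
      using assms by (simp add: L2_set_right_distrib)
    also have "\<dots> \<le> K * l2norm y" using assms by (intro mult_left_mono L2_set_le_l2norm)
    finally show ?thesis .
  qed
  thus "l2 x" "l2norm x \<le> K * l2norm y" by (auto intro: l2_boundI)
qed

lemma l2norm_triangle:
  assumes "l2 x" "l2 y"
  shows "l2 (\<lambda>n. x n + y n)" "l2norm (\<lambda>n. x n + y n) \<le> l2norm x + l2norm y"
proof -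
  have "L2_set (\<lambda>n. cmod (x n + y n)) {..<N} \<le> l2norm x + l2norm y" for N
  proof -
    have "L2_set (\<lambda>n. cmod (x n + y n)) {..<N} \<le> L2_set (\<lambda>n. cmod (x n) + cmod (y n)) {..<N}"
      by (intro L2_set_mono norm_triangle_ineq) auto
    also have "\<dots> \<le> L2_set (\<lambda>n. cmod (x n)) {..<N} + L2_set (\<lambda>n. cmod (y n)) {..<N}"
      by (rule L2_set_triangle_ineq)
    also have "\<dots> \<le> l2norm x + l2norm y" using assms by (intro add_mono L2_set_le_l2norm)
    finally show ?thesis .
  qed
  thus "l2 (\<lambda>n. x n + y n)" "l2norm (\<lambda>n. x n + y n) \<le> l2norm x + l2norm y"
    by (auto intro: l2_boundI)
qed

lemma l2_scale: "l2 x \<Longrightarrow> l2 (\<lambda>n. a * x n)"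
  by (rule l2norm_dominated(1)[where y=x and K="cmod a"]) (auto simp: norm_mult)

lemma l2_diff: "l2 x \<Longrightarrow> l2 y \<Longrightarrow> l2 (\<lambda>n. x n - y n)"
  using l2norm_triangle(1)[of x "\<lambda>n. (-1) * y n"] l2_scale[of y "-1"] by simp

text \<open>Coordinates are Cauchy and have limits; the Cauchy estimate survives the limit on each
  finite section, and then on the whole sequence.\<close>

lemma l2_complete:
  fixes d :: "nat \<Rightarrow> nat \<Rightarrow> complex"
  assumes l2: "\<And>m. l2 (d m)"
    and Cauchy: "\<And>\<epsilon>. \<epsilon> > 0 \<Longrightarrow> \<exists>M. \<forall>m\<ge>M. \<forall>n\<ge>M. l2norm (\<lambda>i. d m i - d n i) < \<epsilon>"
  obtains x where "l2 x" "(\<lambda>m. l2norm (\<lambda>i. d m i - x i)) \<longlonglongrightarrow> 0"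
proof -
  have "Cauchy (\<lambda>m. d m i)" for i
  proof (rule CauchyI)
    fix \<epsilon> :: real assume "\<epsilon> > 0"
    then obtain M where M: "\<forall>m\<ge>M. \<forall>n\<ge>M. l2norm (\<lambda>i. d m i - d n i) < \<epsilon>" using Cauchy by blast
    have "cmod (d m i - d n i) < \<epsilon>" if "m \<ge> M" "n \<ge> M" for m n
      using M that cmod_le_l2norm[OF l2_diff[OF l2[of m] l2[of n]], of i] by (meson order_le_less_trans)
    thus "\<exists>M. \<forall>m\<ge>M. \<forall>n\<ge>M. norm (d m i - d n i) < \<epsilon>" by blast
  qed
  hence "\<forall>i. \<exists>l. (\<lambda>m. d m i) \<longlonglongrightarrow> l" by (auto simp: Cauchy_convergent_iff convergent_def)
  then obtain x where x: "\<And>i. (\<lambda>m. d m i) \<longlonglongrightarrow> x i" by metis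
  have main: "\<exists>M. \<forall>m\<ge>M. l2 (\<lambda>i. d m i - x i) \<and> l2norm (\<lambda>i. d m i - x i) \<le> \<epsilon>" if "\<epsilon> > 0" for \<epsilon>
  proof -
    obtain M where M: "\<forall>m\<ge>M. \<forall>n\<ge>M. l2norm (\<lambda>i. d m i - d n i) < \<epsilon>" using Cauchy \<open>\<epsilon> > 0\<close> by blast
    have "L2_set (\<lambda>i. cmod (d m i - x i)) {..<N} \<le> \<epsilon>" if "m \<ge> M" for m N
    proof (rule tendsto_upperbound)
      show "(\<lambda>n. L2_set (\<lambda>i. cmod (d m i - d n i)) {..<N}) \<longlonglongrightarrow> L2_set (\<lambda>i. cmod (d m i - x i)) {..<N}"
        unfolding L2_set_def by (intro tendsto_intros x)
      show "\<forall>\<^sub>F n in sequentially. L2_set (\<lambda>i. cmod (d m i - d n i)) {..<N} \<le> \<epsilon>"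
        using eventually_ge_at_top[of M]
      proof eventually_elim
        case (elim n)
        thus ?case using M that L2_set_le_l2norm[OF l2_diff[OF l2[of m] l2[of n]], of N]
          by (meson less_imp_le order_trans)
      qed
    qed auto
    thus ?thesis using l2_boundI[of "\<lambda>i. d _ i - x i" \<epsilon>] by blast
  qed
  \<comment> \<open>The limit is square-summable as the difference of \<open>d M\<close> and
    \<open>d M - x\<close>.\<close>
  obtain M where "l2 (\<lambda>i. d M i - x i)" using main[of 1] by auto
  from l2_diff[OF l2[of M] this] have "l2 x" by simp
  moreover have "(\<lambda>m. l2norm (\<lambda>i. d m i - x i)) \<longlonglongrightarrow> 0"
  proof (rule LIMSEQ_I)
    fix r :: real assume "r > 0"
    then obtain M where "\<forall>m\<ge>M. l2 (\<lambda>i. d m i - x i) \<and> l2norm (\<lambda>i. d m i - x i) \<le> r/2"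
      using main[of "r/2"] by auto
    thus "\<exists>no. \<forall>n\<ge>no. norm (l2norm (\<lambda>i. d n i - x i) - 0) < r"
      using \<open>r > 0\<close> by (intro exI[of _ M]) fastforce
  qed
  ultimately show thesis using that by blast
qed

text \<open>The discrete Hardy inequality for p = 2. A quadratic inequality is summed
  telescopically, and Cauchy-Schwarz then allows one factor of the norm of \<open>A\<close> to be
  cancelled.\<close>

lemma hardy_sum:
  fixes a :: "nat \<Rightarrow> real"
  assumes "\<And>n. a n \<ge> 0"
  defines "A \<equiv> \<lambda>n. (\<Sum>i\<le>n. a i) / real (Suc n)"
  shows "L2_set A {..<N} \<le> 2 * L2_set a {..<N}"
proof -
  \<comment> \<open>For n = m + 1 the right side minus the left side is exactly (m + 1) (A n - A
    m)^2; for n = 0 both sides agree.\<close>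
  have rec: "(A n)\<^sup>2 - 2 * A n * a n \<le> real n * (if n = 0 then 0 else (A (n - 1))\<^sup>2) - real (Suc n) * (A n)\<^sup>2" for n
  proof (cases n)
    case 0 thus ?thesis by (simp add: A_def power2_eq_square)
  next
    case (Suc m)
    have "(\<Sum>i\<le>n. a i) = (real m + 2) * A n" "(\<Sum>i\<le>m. a i) = (real m + 1) * A m"
      unfolding A_def Suc by (auto simp: field_simps)
    hence a: "a n = (real m + 2) * A n - (real m + 1) * A m"
      unfolding Suc by simp
    have "(real m + 1) * (A n - A m)\<^sup>2 \<ge> 0" by simp
    thus ?thesis unfolding a using Suc by (simp add: power2_eq_square algebra_simps)
  qed
  have "(\<Sum>n<N. (A n)\<^sup>2 - 2 * A n * a n) \<le> - real N * (if N = 0 then 0 else (A (N - 1))\<^sup>2)"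
  proof (induction N)
    case (Suc N)
    thus ?case using rec[of N] by (simp add: algebra_simps)
  qed simp
  also have "\<dots> \<le> 0" by auto
  finally have "(\<Sum>n<N. (A n)\<^sup>2) \<le> 2 * (\<Sum>n<N. A n * a n)"
    by (simp add: sum_subtractf sum_distrib_left mult.assoc)
  also have "(\<Sum>n<N. A n * a n) \<le> (\<Sum>n<N. \<bar>A n\<bar> * \<bar>a n\<bar>)"
    by (intro sum_mono) (metis abs_ge_self abs_mult)
  also have "\<dots> \<le> L2_set A {..<N} * L2_set a {..<N}" by (rule L2_set_mult_ineq)
  finally have "(L2_set A {..<N})\<^sup>2 \<le> 2 * (L2_set A {..<N} * L2_set a {..<N})"
    by (simp add: L2_set_def sum_nonneg)
  hence *: "L2_set A {..<N} * L2_set A {..<N} \<le> L2_set A {..<N} * (2 * L2_set a {..<N})"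
    by (simp add: power2_eq_square)
  show ?thesis
  \<comment> \<open>Cancelling the common factor requires it to be nonzero; if it is zero the claim
    is immediate.\<close>
  proof (cases "L2_set A {..<N} = 0")
    case False
    hence "L2_set A {..<N} > 0" using L2_set_nonneg[of A "{..<N}"] by linarith
    thus ?thesis using * by (simp only: mult_le_cancel_left_pos)
  qed simp
qed

section \<open>Difference operators, the shift and the Leibniz rule\<close>

definition nabla :: "(nat \<Rightarrow> complex) \<Rightarrow> nat \<Rightarrow> complex" where
  "nabla x n = x n - (if n = 0 then 0 else x (n - 1))"

text \<open>The right shift T on coefficients; \<open>nabla\<close> is I - T.\<close>

definition rshift :: "(nat \<Rightarrow> complex) \<Rightarrow> nat \<Rightarrow> complex" where
  "rshift x n = (if n = 0 then 0 else x (n - 1))"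

text \<open>Forward differences have no boundary term and annihilate constants. Multipliers and
  phases are therefore measured with \<open>fwd\<close>, coefficient sequences with
  \<open>nabla\<close>.\<close>

definition fwd :: "(nat \<Rightarrow> 'a::ab_group_add) \<Rightarrow> nat \<Rightarrow> 'a" where
  "fwd a n = a (Suc n) - a n"

lemma sum_nabla: "(\<Sum>i\<le>n. nabla x i) = x n"
  by (induction n) (auto simp: nabla_def)

lemma nabla_partial_sum: "nabla (\<lambda>n. \<Sum>i\<le>n. x i) = x"
proof
  fix n show "nabla (\<lambda>n. \<Sum>i\<le>n. x i) n = x n" by (cases n) (auto simp: nabla_def)
qed

text \<open>Partial summation is a right inverse of \<open>nabla\<close>. This lifts limits of
  differences back to sequences in the completeness proof.\<close>

lemma nabla_pow_surj: "\<exists>x. (nabla ^^ k) x = d"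
proof (induction k arbitrary: d)
  case (Suc k)
  then obtain x where "(nabla ^^ k) x = (\<lambda>n. \<Sum>i\<le>n. d i)" by blast
  thus ?case by (intro exI[of _ x]) (simp add: nabla_partial_sum)
qed simp

lemma nabla_pow_add: "(nabla ^^ k) (\<lambda>n. x n + y n) = (\<lambda>n. (nabla ^^ k) x n + (nabla ^^ k) y n)"
  by (induction k) (auto simp: nabla_def fun_eq_iff)

lemma nabla_pow_scale: "(nabla ^^ k) (\<lambda>n. a * x n) = (\<lambda>n. a * (nabla ^^ k) x n)"
  by (induction k) (auto simp: nabla_def fun_eq_iff algebra_simps)

lemma nabla_pow_rshift: "(nabla ^^ k) (rshift x) = rshift ((nabla ^^ k) x)"
  by (induction k) (auto simp: nabla_def rshift_def fun_eq_iff)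

text \<open>Leibniz rule. Writing the second term as a shifted product is convenient because
  \<open>rshift\<close> commutes with \<open>nabla\<close> and preserves the l2 norm.\<close>

lemma nabla_mult:
  "nabla (\<lambda>n. a n * y n) = (\<lambda>n. a n * nabla y n + rshift (\<lambda>n. fwd a n * y n) n)"
  by (auto simp: nabla_def rshift_def fwd_def fun_eq_iff algebra_simps)

lemma nabla_pow_mult_Suc:
  "(nabla ^^ Suc k) (\<lambda>n. a n * y n) =
     (\<lambda>n. (nabla ^^ k) (\<lambda>n. a n * nabla y n) n + rshift ((nabla ^^ k) (\<lambda>n. fwd a n * y n)) n)"
  by (simp add: funpow_Suc_right nabla_mult nabla_pow_add nabla_pow_rshift del: funpow.simps)

lemma l2norm_rshift:
  assumes "l2 x"
  shows "l2 (rshift x)" "l2norm (rshift x) = l2norm x"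
proof -
  have *: "(\<lambda>n. (cmod (rshift x (Suc n)))\<^sup>2) = (\<lambda>n. (cmod (x n))\<^sup>2)" by (simp add: rshift_def)
  show l: "l2 (rshift x)" using assms unfolding l2_def by (subst summable_Suc_iff[symmetric]) (simp add: *)
  show "l2norm (rshift x) = l2norm x"
    using suminf_split_head[OF l[unfolded l2_def]] by (simp add: l2norm_def *) (simp add: rshift_def)
qed

text \<open>Iterated Hardy inequality: each weight 1 / (n + 1) costs one difference and a factor
  2.\<close>

lemma hardy:
  assumes "l2 ((nabla ^^ r) x)"
  shows "l2 (\<lambda>n. x n / of_nat (Suc n) ^ r)"
    and "l2norm (\<lambda>n. x n / of_nat (Suc n) ^ r) \<le> 2 ^ r * l2norm ((nabla ^^ r) x)"
proof -
  have "l2 (\<lambda>n. x n / of_nat (Suc n) ^ r) \<and>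
        l2norm (\<lambda>n. x n / of_nat (Suc n) ^ r) \<le> 2 ^ r * l2norm ((nabla ^^ r) x)"
    using assms
  proof (induction r arbitrary: x)
    case (Suc r)
    define y where "y = (\<lambda>n. nabla x n / of_nat (Suc n) ^ r)"
    have IH: "l2 y" "l2norm y \<le> 2 ^ r * l2norm ((nabla ^^ Suc r) x)"
      using Suc.IH[of "nabla x"] Suc.prems by (simp_all add: y_def funpow_Suc_right del: funpow.simps)
    define A where "A = (\<lambda>n. (\<Sum>i\<le>n. cmod (y i)) / real (Suc n))"
    \<comment> \<open>Since x is the partial sum of \<open>nabla x\<close> and the weights increase,
      the weighted x is dominated by the running mean of the weighted \<open>nabla x\<close>, to
      which \<open>hardy_sum\<close> applies.\<close>
    have le: "cmod (x n / of_nat (Suc n) ^ Suc r) \<le> A n" for n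
    proof -
      have "cmod (x n) \<le> (\<Sum>i\<le>n. cmod (nabla x i))"
        by (subst sum_nabla[symmetric]) (rule norm_sum)
      also have "\<dots> \<le> (\<Sum>i\<le>n. cmod (y i) * real (Suc n) ^ r)"
      proof (rule sum_mono)
        fix i assume "i \<in> {..n}"
        have "cmod (nabla x i) = cmod (y i) * real (Suc i) ^ r"
          by (simp add: y_def norm_divide norm_power del: of_nat_Suc)
        also have "\<dots> \<le> cmod (y i) * real (Suc n) ^ r"
          using \<open>i \<in> {..n}\<close> by (intro mult_left_mono power_mono) auto
        finally show "cmod (nabla x i) \<le> cmod (y i) * real (Suc n) ^ r" .
      qed
      also have "\<dots> = A n * real (Suc n) ^ Suc r"
        by (simp add: A_def sum_distrib_right[symmetric] del: of_nat_Suc)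
      finally show ?thesis
        by (simp add: norm_divide norm_power divide_le_eq norm_mult del: of_nat_Suc)
    qed
    have "L2_set (\<lambda>n. cmod (x n / of_nat (Suc n) ^ Suc r)) {..<N} \<le> 2 ^ Suc r * l2norm ((nabla ^^ Suc r) x)" for N
    proof -
      have "L2_set (\<lambda>n. cmod (x n / of_nat (Suc n) ^ Suc r)) {..<N} \<le> L2_set A {..<N}"
        by (intro L2_set_mono le) auto
      also have "\<dots> \<le> 2 * L2_set (\<lambda>n. cmod (y n)) {..<N}" unfolding A_def by (rule hardy_sum) auto
      also have "\<dots> \<le> 2 * l2norm y" using L2_set_le_l2norm[OF IH(1)] by simp
      also have "\<dots> \<le> 2 ^ Suc r * l2norm ((nabla ^^ Suc r) x)" using IH(2) by simp
      finally show ?thesis .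
    qed
    thus ?case by (auto intro: l2_boundI)
  qed auto
  thus "l2 (\<lambda>n. x n / of_nat (Suc n) ^ r)"
    and "l2norm (\<lambda>n. x n / of_nat (Suc n) ^ r) \<le> 2 ^ r * l2norm ((nabla ^^ r) x)" by auto
qed

section \<open>Multipliers\<close>

text \<open>A discrete analogue of a symbol class of order -r, tested on k differences. The single
  constant \<open>B\<close> serves all orders, so that families can be bounded uniformly; index n
  carries weight n + 1 because sequences start at 0.\<close>

definition symbol :: "nat \<Rightarrow> nat \<Rightarrow> real \<Rightarrow> (nat \<Rightarrow> complex) \<Rightarrow> bool" where
  "symbol k r B a \<longleftrightarrow> (\<forall>j\<le>k. \<forall>n. real (Suc n) ^ (j + r) * cmod ((fwd ^^ j) a n) \<le> B)"

text \<open>One difference is traded for one more power of decay, which keeps the Leibniz induction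
  inside these classes.\<close>

lemma symbol_fwd: "symbol (Suc k) r B a \<Longrightarrow> symbol k (Suc r) B (fwd a)"
  unfolding symbol_def
proof (intro allI impI)
  fix j n assume *: "\<forall>j\<le>Suc k. \<forall>n. real (Suc n) ^ (j + r) * cmod ((fwd ^^ j) a n) \<le> B" and "j \<le> k"
  have "real (Suc n) ^ (Suc j + r) * cmod ((fwd ^^ Suc j) a n) \<le> B" using * \<open>j \<le> k\<close> by blast
  thus "real (Suc n) ^ (j + Suc r) * cmod ((fwd ^^ j) (fwd a) n) \<le> B"
    by (simp add: funpow_Suc_right del: funpow.simps of_nat_Suc)
qed

lemma symbol_le: "symbol k r B a \<Longrightarrow> l \<le> k \<Longrightarrow> symbol l r B a"
  by (auto simp: symbol_def)

lemma symbol_Suc: "symbol (Suc k) r B a \<longleftrightarrow>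
    symbol k r B a \<and> (\<forall>n. real (Suc n) ^ (Suc k + r) * cmod ((fwd ^^ Suc k) a n) \<le> B)"
  unfolding symbol_def by (metis le_Suc_eq)

lemma symbol_bound: "symbol k r B a \<Longrightarrow> real (Suc n) ^ (k + r) * cmod ((fwd ^^ k) a n) \<le> B"
  by (auto simp: symbol_def)

lemma symbol_nonneg: "symbol k r B a \<Longrightarrow> B \<ge> 0"
  using symbol_bound[of k r B a 0] by (rule order_trans[rotated]) auto

lemma symbol_multiplier_0:
  assumes "symbol 0 r B a"
  shows "cmod (a n * x n) \<le> B * cmod (x n / of_nat (Suc n) ^ r)"
proof -
  have "real (Suc n) ^ r * cmod (a n) \<le> B" using symbol_bound[OF assms] by simp
  hence "cmod (a n) \<le> B / real (Suc n) ^ r" by (simp add: field_simps del: of_nat_Suc)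
  hence "cmod (a n) * cmod (x n) \<le> B / real (Suc n) ^ r * cmod (x n)" by (rule mult_right_mono) simp
  thus ?thesis by (simp add: norm_mult norm_divide norm_power del: of_nat_Suc)
qed

text \<open>The Leibniz rule leads from k + 1 to the pairs (k, r) for \<open>a\<close> acting on
  \<open>nabla x\<close> and (k, r + 1) for \<open>fwd a\<close> acting on x; both use k + 1 + r
  differences of x. The base case is Hardy's inequality. The two terms contribute in the ratio 1 :
  2, whence the powers of 3.\<close>

lemma symbol_multiplier:
  assumes "symbol k r B a" "l2 ((nabla ^^ (k + r)) x)"
  shows "l2 ((nabla ^^ k) (\<lambda>n. a n * x n)) \<and>
     l2norm ((nabla ^^ k) (\<lambda>n. a n * x n)) \<le> B * 2 ^ r * 3 ^ k * l2norm ((nabla ^^ (k + r)) x)"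
  using assms
proof (induction k arbitrary: r a x)
  case 0
  note h = hardy[of r x] and m = symbol_multiplier_0[OF 0(1), of _ x] and B = symbol_nonneg[OF 0(1)]
  have "l2norm (\<lambda>n. a n * x n) \<le> B * l2norm (\<lambda>n. x n / of_nat (Suc n) ^ r)"
    by (rule l2norm_dominated(2)[OF h(1) m B]) (use 0 in auto)
  also have "\<dots> \<le> B * (2 ^ r * l2norm ((nabla ^^ r) x))" using h 0 B by (intro mult_left_mono) auto
  finally show ?case using l2norm_dominated(1)[OF h(1) m B] 0 by (simp add: mult_ac)
next
  case (Suc k)
  let ?M = "l2norm ((nabla ^^ (Suc k + r)) x)"
  have 1: "l2 ((nabla ^^ k) (\<lambda>n. a n * nabla x n)) \<and>
     l2norm ((nabla ^^ k) (\<lambda>n. a n * nabla x n)) \<le> B * 2 ^ r * 3 ^ k * ?M"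
    using Suc.IH[of r a "nabla x"] Suc.prems symbol_le[OF Suc.prems(1), of k]
    by (simp add: funpow_Suc_right del: funpow.simps)
  have 2: "l2 ((nabla ^^ k) (\<lambda>n. fwd a n * x n)) \<and>
     l2norm ((nabla ^^ k) (\<lambda>n. fwd a n * x n)) \<le> B * 2 ^ Suc r * 3 ^ k * ?M"
    using Suc.IH[of "Suc r" "fwd a" x] Suc.prems symbol_fwd by simp
  note t = l2norm_triangle[OF conjunct1[OF 1] l2norm_rshift(1)[OF conjunct1[OF 2]]]
  show ?case unfolding nabla_pow_mult_Suc using t 1 2 l2norm_rshift(2)[OF conjunct1[OF 2]]
    by (auto simp: algebra_simps)
qed

text \<open>The same induction as for \<open>symbol_multiplier\<close>, with dominated convergence
  replacing the norm bound in the base case.\<close>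

lemma symbol_multiplier_tendsto_0:
  assumes "F \<noteq> bot" "eventually (\<lambda>t. symbol k r B (m t)) F" "\<And>n. ((\<lambda>t. m t n) \<longlongrightarrow> 0) F"
    and "l2 ((nabla ^^ (k + r)) x)"
  shows "((\<lambda>t. l2norm ((nabla ^^ k) (\<lambda>n. m t n * x n))) \<longlongrightarrow> 0) F"
  using assms(2-)
proof (induction k arbitrary: r m x)
  case 0
  \<comment> \<open>\<open>B * cmod (y n)\<close> is the majorant for Tannery's theorem; it is
    square-summable by Hardy's inequality.\<close>
  define y where "y = (\<lambda>n. x n / of_nat (Suc n) ^ r)"
  have "l2 y" unfolding y_def using 0 by (intro hardy) auto
  have ev: "eventually (\<lambda>t. \<forall>n. cmod (m t n * x n) \<le> B * cmod (y n)) F"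
    using 0(1) by eventually_elim (use symbol_multiplier_0 in \<open>auto simp: y_def\<close>)
  have "((\<lambda>t. \<Sum>n. (cmod (m t n * x n))\<^sup>2) \<longlongrightarrow> (\<Sum>n. 0)) F"
  proof (rule tannerys_theorem[where M="\<lambda>n. (B * cmod (y n))\<^sup>2", THEN conjunct2, THEN conjunct2])
    show "((\<lambda>t. (cmod (m t n * x n))\<^sup>2) \<longlongrightarrow> 0) F" for n
      by (rule tendsto_eq_intros 0 refl | simp)+
    show "\<forall>\<^sub>F (n, t) in at_top \<times>\<^sub>F F. norm ((cmod (m t n * x n))\<^sup>2) \<le> (B * cmod (y n))\<^sup>2"
    proof -
      \<comment> \<open>The eventual bound holds for all n at once, so it pulls back along the
        projection to \<open>F\<close>.\<close>
      have "\<forall>\<^sub>F p in at_top \<times>\<^sub>F F. \<forall>n. cmod (m (snd p) n * x n) \<le> B * cmod (y n)"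
        by (rule eventually_compose_filterlim[OF ev filterlim_snd])
      thus ?thesis by eventually_elim (auto intro!: power_mono)
    qed
    show "summable (\<lambda>n. (B * cmod (y n))\<^sup>2)"
      using \<open>l2 y\<close> by (simp add: power_mult_distrib summable_mult l2_def)
  qed (use assms in auto)
  hence "((\<lambda>t. sqrt (\<Sum>n. (cmod (m t n * x n))\<^sup>2)) \<longlongrightarrow> sqrt 0) F"
    by (intro tendsto_real_sqrt) simp
  thus ?case by (simp add: l2norm_def)
next
  case (Suc k)
  let ?a = "\<lambda>t. (nabla ^^ k) (\<lambda>n. m t n * nabla x n)" and ?b = "\<lambda>t. (nabla ^^ k) (\<lambda>n. fwd (m t) n * x n)"
  have x: "l2 ((nabla ^^ (k + r)) (nabla x))" "l2 ((nabla ^^ (k + Suc r)) x)"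
    using Suc.prems(3) by (simp_all add: funpow_Suc_right del: funpow.simps)
  have sa: "\<forall>\<^sub>F t in F. symbol k r B (m t)" using Suc.prems(1) by eventually_elim (rule symbol_le, auto)
  have sb: "\<forall>\<^sub>F t in F. symbol k (Suc r) B (fwd (m t))"
    using Suc.prems(1) by eventually_elim (rule symbol_fwd)
  have A: "((\<lambda>t. l2norm (?a t)) \<longlongrightarrow> 0) F"
    by (rule Suc.IH[OF sa Suc.prems(2) x(1)])
  have "((\<lambda>t. fwd (m t) n) \<longlongrightarrow> 0) F" for n
    unfolding fwd_def using tendsto_diff[OF Suc.prems(2)[of "Suc n"] Suc.prems(2)[of n]] by simp
  hence B: "((\<lambda>t. l2norm (?b t)) \<longlongrightarrow> 0) F"
    by (intro Suc.IH[OF sb _ x(2)])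
  have le: "\<forall>\<^sub>F t in F. 0 \<le> l2norm ((nabla ^^ Suc k) (\<lambda>n. m t n * x n)) \<and>
      l2norm ((nabla ^^ Suc k) (\<lambda>n. m t n * x n)) \<le> l2norm (?a t) + l2norm (?b t)"
    using sa sb
  proof eventually_elim
    case (elim t)
    have 1: "l2 (?a t)" "l2 (?b t)"
      using symbol_multiplier[OF elim(1) x(1)] symbol_multiplier[OF elim(2) x(2)] by auto
    note t = l2norm_triangle[OF 1(1) l2norm_rshift(1)[OF 1(2)]]
    show ?case unfolding nabla_pow_mult_Suc using t l2norm_rshift(2)[OF 1(2)] by simp
  qed
  show ?case
    by (rule tendsto_sandwich[OF _ _ tendsto_const tendsto_add_zero[OF A B]])
       (use le in \<open>auto elim: eventually_mono\<close>)
qed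

section \<open>Exponentials of slowly varying sequences\<close>

text \<open>Stated on \<open>closed_segment\<close> so that b may lie on either side of a; negative
  times occur later.\<close>

lemma vector_mean_value_bound:
  fixes h :: "real \<Rightarrow> 'a::real_normed_vector"
  assumes "\<And>s. s \<in> closed_segment a b \<Longrightarrow> (h has_vector_derivative h' s) (at s)"
    and "\<And>s. s \<in> closed_segment a b \<Longrightarrow> norm (h' s) \<le> B"
  shows "norm (h b - h a) \<le> B * \<bar>b - a\<bar>"
proof -
  have "norm (h b - h a) \<le> B * norm (b - a)"
  proof (rule differentiable_bound[OF convex_closed_segment[of a b], where f'="\<lambda>s x. x *\<^sub>R h' s"])
    fix s assume s: "s \<in> closed_segment a b"
    show "(h has_derivative (\<lambda>x. x *\<^sub>R h' s)) (at s within closed_segment a b)"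
      using assms(1)[OF s] by (metis has_vector_derivative_def has_derivative_at_withinI)
    have "onorm (\<lambda>x::real. x *\<^sub>R h' s) \<le> norm (h' s)" by (rule onorm_bound) (auto simp: mult.commute)
    thus "onorm (\<lambda>x. x *\<^sub>R h' s) \<le> B" using assms(2)[OF s] by linarith
  qed auto
  thus ?thesis by simp
qed

lemma fwd_pow_add: "(fwd ^^ k) (\<lambda>n. x n + y n) = (\<lambda>n. (fwd ^^ k) x n + (fwd ^^ k) y n)"
  by (induction k) (auto simp: fwd_def fun_eq_iff)

lemma fwd_pow_scale:
  fixes a :: "'a::comm_ring"
  shows "(fwd ^^ k) (\<lambda>n. a * x n) = (\<lambda>n. a * (fwd ^^ k) x n)"
  by (induction k) (auto simp: fwd_def fun_eq_iff algebra_simps)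

lemma fwd_pow_Suc_shift: "(fwd ^^ k) (\<lambda>n. x (Suc n)) = (\<lambda>n. (fwd ^^ k) x (Suc n))"
  by (induction k) (auto simp: fwd_def fun_eq_iff)

lemma fwd_pow_of_real: "(fwd ^^ k) (\<lambda>n. complex_of_real (g n)) = (\<lambda>n. complex_of_real ((fwd ^^ k) g n))"
  by (induction k) (auto simp: fwd_def fun_eq_iff)

lemma fwd_pow_const: "(fwd ^^ k) (\<lambda>n. c) = (\<lambda>n. if k = 0 then c else 0)"
  by (induction k) (auto simp: fwd_def fun_eq_iff)

text \<open>Differences in n commute with differentiation in the parameter, so the mean value bound
  applies to each difference at a fixed index.\<close>

lemma has_vector_derivative_fwd_pow:
  fixes P :: "real \<Rightarrow> nat \<Rightarrow> 'a::real_normed_vector"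
  assumes "\<And>n. ((\<lambda>s. P s n) has_vector_derivative P' n) F"
  shows "((\<lambda>s. (fwd ^^ k) (P s) n) has_vector_derivative (fwd ^^ k) P' n) F"
proof (induction k arbitrary: n)
  case (Suc k)
  show ?case using has_vector_derivative_diff[OF Suc[of "Suc n"] Suc[of n]] by (simp add: fwd_def)
qed (use assms in simp)

lemma symbol_Suc_shift:
  assumes "symbol k r B a"
  shows "symbol k r B (\<lambda>n. a (Suc n))"
  unfolding symbol_def fwd_pow_Suc_shift
proof (intro allI impI)
  fix j n assume "j \<le> k"
  have "real (Suc n) ^ (j + r) * cmod ((fwd ^^ j) a (Suc n))
      \<le> real (Suc (Suc n)) ^ (j + r) * cmod ((fwd ^^ j) a (Suc n))"
    by (intro mult_right_mono power_mono) auto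
  also have "\<dots> \<le> B" using assms \<open>j \<le> k\<close> unfolding symbol_def by blast
  finally show "real (Suc n) ^ (j + r) * cmod ((fwd ^^ j) a (Suc n)) \<le> B" .
qed

text \<open>Orders of decay add under multiplication; each Leibniz step doubles the number of terms,
  giving 2^k.\<close>

lemma symbol_fwd_pow_mult:
  assumes "symbol k r A a" "symbol k s B b"
  shows "real (Suc n) ^ (k + r + s) * cmod ((fwd ^^ k) (\<lambda>n. a n * b n) n) \<le> 2 ^ k * A * B"
  using assms
proof (induction k arbitrary: r s a b)
  case 0
  have "(real (Suc n) ^ r * cmod (a n)) * (real (Suc n) ^ s * cmod (b n)) \<le> A * B"
    using symbol_bound[OF 0(1), of n] symbol_bound[OF 0(2), of n] symbol_nonneg[OF 0(1)]
    by (intro mult_mono) auto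
  thus ?case by (simp add: norm_mult power_add mult_ac del: of_nat_Suc)
next
  case (Suc k)
  let ?x = "(fwd ^^ k) (\<lambda>n. fwd a n * b n) n" and ?y = "(fwd ^^ k) (\<lambda>n. a (Suc n) * fwd b n) n"
  have "fwd (\<lambda>n. a n * b n) = (\<lambda>n. fwd a n * b n + a (Suc n) * fwd b n)"
    by (auto simp: fwd_def algebra_simps)
  hence eq: "(fwd ^^ Suc k) (\<lambda>n. a n * b n) n = ?x + ?y"
    by (simp add: funpow_Suc_right fwd_pow_add del: funpow.simps)
  have 1: "real (Suc n) ^ (k + Suc r + s) * cmod ?x \<le> 2 ^ k * A * B"
    by (rule Suc.IH[OF symbol_fwd[OF Suc.prems(1)] symbol_le[OF Suc.prems(2)]]) simp
  have 2: "real (Suc n) ^ (k + r + Suc s) * cmod ?y \<le> 2 ^ k * A * B"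
    by (rule Suc.IH[OF symbol_Suc_shift[OF symbol_le[OF Suc.prems(1)]] symbol_fwd[OF Suc.prems(2)]]) simp
  have "real (Suc n) ^ (Suc k + r + s) * cmod (?x + ?y) \<le>
      real (Suc n) ^ (Suc k + r + s) * (cmod ?x + cmod ?y)"
    by (intro mult_left_mono norm_triangle_ineq) auto
  also have "\<dots> \<le> 2 ^ Suc k * A * B" using 1 2 by (simp add: algebra_simps del: of_nat_Suc)
  finally show ?case unfolding eq .
qed

text \<open>The constant is chosen before the phase because the induction applies the hypothesis to
  a whole family of interpolated phases. The bounds start at j = 1: the phase may be unbounded,
  since \<open>cis\<close> has modulus 1.\<close>

lemma symbol_cis:
  "\<exists>C. \<forall>g. (\<forall>j\<in>{1..k}. \<forall>n. real (Suc n) ^ j * \<bar>(fwd ^^ j) g n\<bar> \<le> B) \<longrightarrow> symbol k 0 C (\<lambda>n. cis (g n))"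
proof (induction k)
  case 0
  show ?case by (intro exI[of _ 1]) (auto simp: symbol_def)
next
  case (Suc k)
  then obtain C where C: "\<And>g. (\<forall>j\<in>{1..k}. \<forall>n. real (Suc n) ^ j * \<bar>(fwd ^^ j) g n\<bar> \<le> B) \<Longrightarrow>
      symbol k 0 C (\<lambda>n. cis (g n))" by blast
  \<comment> \<open>The second entry is the product bound for the symbols i \<open>fwd g\<close>, of
    order -1, and \<open>P s\<close>, of order 0.\<close>
  define C' where "C' = max C (2 ^ k * B * C)"
  have "symbol (Suc k) 0 C' (\<lambda>n. cis (g n))"
    if g: "\<forall>j\<in>{1..Suc k}. \<forall>n. real (Suc n) ^ j * \<bar>(fwd ^^ j) g n\<bar> \<le> B" for g
  proof -
    have 1: "symbol k 0 C' (\<lambda>n. cis (g n))"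
      using C[of g] g unfolding symbol_def C'_def by (auto simp: le_max_iff_disj)
    have Dg: "symbol k 1 B (\<lambda>n. \<i> * complex_of_real (fwd g n))"
      unfolding symbol_def
    proof (intro allI impI)
      fix j n assume "j \<le> k"
      hence "real (Suc n) ^ Suc j * \<bar>(fwd ^^ Suc j) g n\<bar> \<le> B"
        by (intro g[rule_format]) auto
      thus "real (Suc n) ^ (j + 1) * cmod ((fwd ^^ j) (\<lambda>n. \<i> * complex_of_real (fwd g n)) n) \<le> B"
        by (simp add: fwd_pow_scale fwd_pow_of_real norm_mult funpow_Suc_right del: funpow.simps of_nat_Suc)
    qed
    \<comment> \<open>\<open>P\<close> joins \<open>cis (g n)\<close> at s = 0 to
      \<open>cis (g (Suc n))\<close> at s = 1, so the extra difference becomes an increment in s.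
      Its s-derivative is i \<open>fwd g\<close> times \<open>P s\<close>, a product that needs only
      k differences.\<close>
    define P where "P = (\<lambda>s n. cis (g n + s * fwd g n))"
    have gs: "symbol k 0 C (P s)" if "s \<in> {0..1}" for s
      unfolding P_def
    proof (rule C, intro ballI allI)
      fix j n assume j: "j \<in> {1..k}"
      \<comment> \<open>The interpolated phase is a convex combination of g and its shift, so it
        inherits the same bound B.\<close>
      have "(fwd ^^ j) (\<lambda>n. g n + s * fwd g n) n = (1 - s) * (fwd ^^ j) g n + s * (fwd ^^ j) g (Suc n)"
        by (simp add: fwd_pow_add fwd_pow_scale) (simp add: fwd_def funpow_swap1[symmetric] algebra_simps)
      also have "\<bar>\<dots>\<bar> \<le> (1 - s) * \<bar>(fwd ^^ j) g n\<bar> + s * \<bar>(fwd ^^ j) g (Suc n)\<bar>"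
        using that by (intro order_trans[OF abs_triangle_ineq]) (auto simp: abs_mult)
      finally have "real (Suc n) ^ j * \<bar>(fwd ^^ j) (\<lambda>n. g n + s * fwd g n) n\<bar> \<le>
          (1 - s) * (real (Suc n) ^ j * \<bar>(fwd ^^ j) g n\<bar>) + s * (real (Suc n) ^ j * \<bar>(fwd ^^ j) g (Suc n)\<bar>)"
        by (subst (asm) mult_le_cancel_left_pos[of "real (Suc n) ^ j", symmetric]) (auto simp: algebra_simps)
      also have "\<dots> \<le> (1 - s) * B + s * B"
      proof (intro add_mono mult_left_mono)
        have "real (Suc n) ^ j * \<bar>(fwd ^^ j) g (Suc n)\<bar> \<le> real (Suc (Suc n)) ^ j * \<bar>(fwd ^^ j) g (Suc n)\<bar>"
          by (intro mult_right_mono power_mono) auto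
        also have "\<dots> \<le> B" using g j by (metis atLeastAtMost_iff le_SucI)
        finally show "real (Suc n) ^ j * \<bar>(fwd ^^ j) g (Suc n)\<bar> \<le> B" .
      qed (use g j that in auto)
      finally show "real (Suc n) ^ j * \<bar>(fwd ^^ j) (\<lambda>n. g n + s * fwd g n) n\<bar> \<le> B"
        by (simp add: algebra_simps)
    qed
    have "real (Suc n) ^ (Suc k + 0) * cmod ((fwd ^^ Suc k) (\<lambda>n. cis (g n)) n) \<le> C'" for n
    proof -
      define h' where "h' = (\<lambda>s. (fwd ^^ k) (\<lambda>n. (\<i> * complex_of_real (fwd g n)) * P s n) n)"
      have "cmod ((fwd ^^ k) (P 1) n - (fwd ^^ k) (P 0) n) \<le> (2 ^ k * B * C / real (Suc n) ^ Suc k) * \<bar>1 - 0\<bar>"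
      proof (rule vector_mean_value_bound)
        fix s :: real assume "s \<in> closed_segment 0 1"
        hence s: "s \<in> {0..1}" by (simp add: closed_segment_eq_real_ivl)
        show "((\<lambda>s. (fwd ^^ k) (P s) n) has_vector_derivative h' s) (at s)"
          unfolding h'_def
        proof (rule has_vector_derivative_fwd_pow)
          fix n
          have "((\<lambda>s. cis (g n + s * fwd g n)) has_derivative
             (\<lambda>h. (h * fwd g n) *\<^sub>R (\<i> * cis (g n + s * fwd g n)))) (at s)"
            by (auto intro!: derivative_eq_intros)
          thus "((\<lambda>s. P s n) has_vector_derivative \<i> * complex_of_real (fwd g n) * P s n) (at s)"
            by (simp add: has_vector_derivative_def P_def scaleR_conv_of_real mult_ac)
        qed
        have "real (Suc n) ^ Suc k * cmod (h' s) \<le> 2 ^ k * B * C"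
          using symbol_fwd_pow_mult[OF Dg gs[OF s], of n] by (simp add: h'_def)
        thus "cmod (h' s) \<le> 2 ^ k * B * C / real (Suc n) ^ Suc k"
          by (simp add: pos_le_divide_eq mult_ac del: of_nat_Suc)
      qed
      also have "(fwd ^^ k) (P 1) n - (fwd ^^ k) (P 0) n = (fwd ^^ Suc k) (\<lambda>n. cis (g n)) n"
      proof -
        have "P 1 = (\<lambda>n. cis (g (Suc n)))" "P 0 = (\<lambda>n. cis (g n))" by (auto simp: P_def fwd_def)
        thus ?thesis using fwd_pow_Suc_shift[of k "\<lambda>n. cis (g n)"] by (simp add: fwd_def)
      qed
      finally have "real (Suc n) ^ Suc k * cmod ((fwd ^^ Suc k) (\<lambda>n. cis (g n)) n) \<le> 2 ^ k * B * C"
        by (simp add: pos_le_divide_eq mult_ac del: of_nat_Suc funpow.simps power_Suc)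
      thus ?thesis by (simp add: C'_def le_max_iff_disj)
    qed
    with 1 show ?thesis unfolding symbol_Suc by blast
  qed
  thus ?case by blast
qed

text \<open>The differences of the phase t g scale with t, so \<open>symbol_cis\<close> with bound
  \<open>T * B\<close> yields one constant for the whole interval.\<close>

lemma cis_symbol_bound:
  fixes g :: "nat \<Rightarrow> real"
  assumes "\<forall>j\<in>{1..k}. Bseq (\<lambda>n. real (Suc n) ^ j * (fwd ^^ j) g n)"
  obtains C where "\<And>t. \<bar>t\<bar> \<le> T \<Longrightarrow> symbol k 0 C (\<lambda>n. cis (t * g n))"
proof -
  have "\<forall>j\<in>{1..k}. \<exists>K. \<forall>n. norm (real (Suc n) ^ j * (fwd ^^ j) g n) \<le> K"
    using assms unfolding Bseq_def by blast
  then obtain K where K: "\<And>j n. j \<in> {1..k} \<Longrightarrow> norm (real (Suc n) ^ j * (fwd ^^ j) g n) \<le> K j" by metis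
  \<comment> \<open>The sum of the finitely many nonnegative constants dominates each of
    them.\<close>
  define B where "B = (\<Sum>j=1..k. K j)"
  have K0: "K j \<ge> 0" if "j \<in> {1..k}" for j using K[OF that, of 0] norm_ge_zero order_trans by blast
  have B: "real (Suc n) ^ j * \<bar>(fwd ^^ j) g n\<bar> \<le> B" if "j \<in> {1..k}" for j n
  proof -
    have "K j \<le> B" unfolding B_def using that K0 by (intro member_le_sum) auto
    thus ?thesis using K[OF that, of n] by (simp add: abs_mult del: of_nat_Suc)
  qed
  obtain C where C: "\<And>g. (\<forall>j\<in>{1..k}. \<forall>n. real (Suc n) ^ j * \<bar>(fwd ^^ j) g n\<bar> \<le> T * B) \<Longrightarrow>
      symbol k 0 C (\<lambda>n. cis (g n))" using symbol_cis[of k "T * B"] by blast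
  have "symbol k 0 C (\<lambda>n. cis (t * g n))" if "\<bar>t\<bar> \<le> T" for t
  proof (rule C, intro ballI allI)
    fix j n assume j: "j \<in> {1..k}"
    have "\<bar>t\<bar> * (real (Suc n) ^ j * \<bar>(fwd ^^ j) g n\<bar>) \<le> T * B"
      using that B[OF j] by (intro mult_mono) auto
    thus "real (Suc n) ^ j * \<bar>(fwd ^^ j) (\<lambda>n. t * g n) n\<bar> \<le> T * B"
      by (simp add: fwd_pow_scale abs_mult mult_ac)
  qed
  thus thesis using that by blast
qed

text \<open>Subtracting 1 affects only the bound for j = 0, because positive powers of
  \<open>fwd\<close> annihilate constants.\<close>

lemma symbol_cis_minus_1:
  assumes "symbol k 0 C (\<lambda>n. cis (g n))"
  shows "symbol k 0 (C + 1) (\<lambda>n. cis (g n) - 1)"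
  unfolding symbol_def
proof (intro allI impI)
  fix j n assume "j \<le> k"
  hence 1: "real (Suc n) ^ j * cmod ((fwd ^^ j) (\<lambda>n. cis (g n)) n) \<le> C"
    using assms by (auto simp: symbol_def)
  have "(fwd ^^ j) (\<lambda>n. cis (g n) - 1) n = (fwd ^^ j) (\<lambda>n. cis (g n)) n + (if j = 0 then -1 else 0)"
    using fwd_pow_add[of j "\<lambda>n. cis (g n)" "\<lambda>n. -1"] by (auto simp: fwd_pow_const)
  thus "real (Suc n) ^ (j + 0) * cmod ((fwd ^^ j) (\<lambda>n. cis (g n) - 1) n) \<le> C + 1"
    using 1 norm_triangle_ineq4[of "cis (g n)" 1] by (cases "j = 0") auto
qed

text \<open>
  The first-order Taylor remainder of \<open>t \<mapsto> cis (t * g n)\<close> at \<open>0\<close>, divided by \<open>g n\<close>.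
\<close>

definition cis_rem :: "(nat \<Rightarrow> real) \<Rightarrow> real \<Rightarrow> nat \<Rightarrow> complex" where
  "cis_rem g t n =
     (if g n = 0 then 0 else (cis (t * g n) - 1) / complex_of_real (g n) - \<i> * complex_of_real t)"

lemma cis_rem_0 [simp]: "cis_rem g 0 n = 0"
  by (simp add: cis_rem_def)

text \<open>The error of the difference quotient is a multiplier applied to g c, the sequence
  controlled by the domain condition. Where g vanishes both sides are 0.\<close>

lemma cis_rem_mult:
  assumes "t \<noteq> 0"
  shows "complex_of_real (1 / t) * cis_rem g t n * (complex_of_real (g n) * c) =
    complex_of_real (1 / t) * (cis (t * g n) * c - c) - \<i> * complex_of_real (g n) * c"
  using assms by (auto simp: cis_rem_def field_simps)

text \<open>The factor g produced by differentiation cancels the division by g, leaving a derivative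
  already bounded by \<open>symbol_cis_minus_1\<close>.\<close>

lemma has_vector_derivative_cis_rem:
  "((\<lambda>t. cis_rem g t n) has_vector_derivative \<i> * (cis (t * g n) - 1)) (at t)"
proof (cases "g n = 0")
  case False
  have "((\<lambda>t. (cis (t * g n) - 1) / complex_of_real (g n) - \<i> * complex_of_real t) has_derivative
      (\<lambda>h. ((h * g n) *\<^sub>R (\<i> * cis (t * g n))) / complex_of_real (g n) - \<i> * complex_of_real h)) (at t)"
    by (auto intro!: derivative_eq_intros simp: False fun_eq_iff scaleR_conv_of_real)
  thus ?thesis using False
    by (simp add: has_vector_derivative_def cis_rem_def scaleR_conv_of_real field_simps)
qed (simp add: cis_rem_def)

text \<open>The remainder vanishes at t = 0 and its t-derivative is i (cis (t g) - 1). The mean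
  value bound gives C times the modulus of t, which the factor 1 / t cancels; the quotient by g is
  never differenced directly.\<close>

lemma symbol_cis_rem:
  assumes "\<And>t. \<bar>t\<bar> \<le> 1 \<Longrightarrow> symbol k 0 C (\<lambda>n. cis (t * g n) - 1)" "\<bar>t\<bar> \<le> 1" "t \<noteq> 0"
  shows "symbol k 0 C (\<lambda>n. complex_of_real (1 / t) * cis_rem g t n)"
  unfolding symbol_def
proof (intro allI impI)
  fix j n assume j: "j \<le> k"
  have "cmod ((fwd ^^ j) (cis_rem g t) n - (fwd ^^ j) (cis_rem g 0) n) \<le> (C / real (Suc n) ^ j) * \<bar>t - 0\<bar>"
  proof (rule vector_mean_value_bound)
    fix s assume "s \<in> closed_segment 0 t"
    hence s: "\<bar>s\<bar> \<le> 1" using assms(2) by (auto simp: closed_segment_eq_real_ivl split: if_splits)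
    show "((\<lambda>s. (fwd ^^ j) (cis_rem g s) n) has_vector_derivative (fwd ^^ j) (\<lambda>n. \<i> * (cis (s * g n) - 1)) n) (at s)"
      by (intro has_vector_derivative_fwd_pow has_vector_derivative_cis_rem)
    show "cmod ((fwd ^^ j) (\<lambda>n. \<i> * (cis (s * g n) - 1)) n) \<le> C / real (Suc n) ^ j"
      using assms(1)[OF s] j unfolding symbol_def
      by (simp add: fwd_pow_scale norm_mult pos_le_divide_eq mult_ac del: of_nat_Suc)
  qed
  moreover have "cis_rem g 0 = (\<lambda>n. 0)" by auto
  ultimately have W: "cmod ((fwd ^^ j) (cis_rem g t) n) \<le> C / real (Suc n) ^ j * \<bar>t\<bar>"
    by (simp add: fwd_pow_const del: of_nat_Suc)
  have "cmod ((fwd ^^ j) (\<lambda>n. complex_of_real (1 / t) * cis_rem g t n) n)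
      = cmod ((fwd ^^ j) (cis_rem g t) n) / \<bar>t\<bar>"
    by (simp add: fwd_pow_scale norm_mult norm_divide del: of_real_divide) 
  also have "\<dots> \<le> C / real (Suc n) ^ j" using W assms(3) by (simp add: pos_divide_le_eq del: of_nat_Suc)
  finally show "real (Suc n) ^ (j + 0) * cmod ((fwd ^^ j) (\<lambda>n. complex_of_real (1 / t) * cis_rem g t n) n) \<le> C"
    by (simp add: pos_le_divide_eq mult_ac del: of_nat_Suc)
qed

text \<open>At fixed n the remainder has value 0 and derivative 0 at t = 0.\<close>

lemma cis_rem_tendsto_0: "((\<lambda>t. complex_of_real (1 / t) * cis_rem g t n) \<longlongrightarrow> 0) (at 0)"
proof -
  have "((\<lambda>t. cis_rem g t n) has_derivative (\<lambda>h. 0)) (at 0)"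
    using has_vector_derivative_cis_rem[of g n 0] by (simp add: has_vector_derivative_def)
  hence "((\<lambda>t. norm (cis_rem g t n) / norm t) \<longlongrightarrow> 0) (at 0)"
    unfolding has_derivative_at by simp
  hence "((\<lambda>t. norm (complex_of_real (1 / t) * cis_rem g t n)) \<longlongrightarrow> 0) (at 0)"
    by (simp add: norm_mult norm_divide)
  thus ?thesis by (rule tendsto_norm_zero_cancel)
qed

section \<open>Riesz bases and the norm of \<open>H\<^sub>k\<close>\<close>

instance complex_hilbert \<subseteq> banach ..

lemma norm_scaleC: "norm (z *\<^sub>C h) = cmod z * norm h" for h :: "'h::complex_inner"
proof -
  have "cinner (z *\<^sub>C h) (z *\<^sub>C h) = z * cnj (z * cinner h h)"
    by (metis cinner_scaleC_left cinner_commute)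
  also have "\<dots> = z * cnj z * cinner h h"
    by (metis complex_cnj_mult cinner_commute mult.assoc)
  finally have "(norm (z *\<^sub>C h))\<^sup>2 = (cmod z * norm h)\<^sup>2"
    by (simp add: power2_norm_eq_inner inner_eq_Re_cinner power_mult_distrib
        complex_norm_square[symmetric] flip: of_real_power)
  thus ?thesis by simp
qed

lemma orthonormal_norm_sum:
  fixes u :: "nat \<Rightarrow> 'h::complex_hilbert"
  assumes u: "\<And>m n. cinner (u m) (u n) = (if m = n then 1 else 0)" and "finite I"
  shows "norm (\<Sum>n\<in>I. d n *\<^sub>C u n) = L2_set (\<lambda>n. cmod (d n)) I"
proof -
  have ci: "cinner (a *\<^sub>C u m) (b *\<^sub>C u n) = (if m = n then a * cnj b else 0)" for a b m n
  proof -
    have "cinner (a *\<^sub>C u m) (b *\<^sub>C u n) = a * cnj (b * cinner (u n) (u m))"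
      by (simp add: cinner_scaleC_left cinner_commute[of "u m"])
    thus ?thesis by (simp add: u)
  qed
  have norm_u: "norm (u n) = 1" for n
    by (simp add: norm_eq_sqrt_inner inner_eq_Re_cinner u)
  have "(norm (\<Sum>n\<in>I. d n *\<^sub>C u n))\<^sup>2 = (\<Sum>n\<in>I. (norm (d n *\<^sub>C u n))\<^sup>2)"
    by (rule norm_sum_Pythagorean[OF \<open>finite I\<close>])
       (auto simp: pairwise_def orthogonal_def inner_eq_Re_cinner ci)
  also have "\<dots> = (\<Sum>n\<in>I. (cmod (d n))\<^sup>2)"
    by (simp add: norm_scaleC norm_u)
  finally show ?thesis unfolding L2_set_def by (metis norm_ge_zero real_sqrt_unique)
qed

text \<open>Pythagoras makes the partial sums Cauchy; the norm identity is the limit of the finite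
  one.\<close>

lemma orthonormal_series:
  fixes u :: "nat \<Rightarrow> 'h::complex_hilbert"
  assumes u: "\<And>m n. cinner (u m) (u n) = (if m = n then 1 else 0)" and d: "l2 d"
  shows "summable (\<lambda>n. d n *\<^sub>C u n)" "norm (\<Sum>n. d n *\<^sub>C u n) = l2norm d"
proof -
  show s: "summable (\<lambda>n. d n *\<^sub>C u n)"
    unfolding summable_Cauchy
  proof (intro allI impI)
    fix e :: real assume "e > 0"
    hence "e\<^sup>2 > 0" by simp
    with d obtain N where N: "\<forall>m\<ge>N. \<forall>n. norm (\<Sum>i=m..<n. (cmod (d i))\<^sup>2) < e\<^sup>2"
      unfolding l2_def summable_Cauchy by blast
    have "norm (\<Sum>i=m..<n. d i *\<^sub>C u i) < e" if "m \<ge> N" for m n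
    proof -
      have "(\<Sum>i=m..<n. (cmod (d i))\<^sup>2) < e\<^sup>2" using N that by (smt (verit) real_norm_def)
      thus ?thesis using \<open>e > 0\<close> real_sqrt_less_mono[of _ "e\<^sup>2"]
        by (simp add: orthonormal_norm_sum[OF u] L2_set_def)
    qed
    thus "\<exists>N. \<forall>m\<ge>N. \<forall>n. norm (\<Sum>i=m..<n. d i *\<^sub>C u i) < e" by blast
  qed
  have "(\<lambda>N. norm (\<Sum>n<N. d n *\<^sub>C u n)) \<longlonglongrightarrow> norm (\<Sum>n. d n *\<^sub>C u n)"
    using s by (intro tendsto_norm summable_LIMSEQ)
  moreover have "(\<lambda>N. norm (\<Sum>n<N. d n *\<^sub>C u n)) \<longlonglongrightarrow> l2norm d"
    using d unfolding orthonormal_norm_sum[OF u finite_lessThan] L2_set_def l2norm_def l2_def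
    by (intro tendsto_real_sqrt summable_LIMSEQ)
  ultimately show "norm (\<Sum>n. d n *\<^sub>C u n) = l2norm d" by (rule LIMSEQ_unique)
qed

text \<open>The norm equivalence through which the Riesz basis enters. For e = S u, the constant
  \<open>b\<close> bounds S and \<open>a\<close> bounds its inverse.\<close>

locale riesz_bounds =
  fixes e :: "nat \<Rightarrow> 'h::complex_hilbert" and a b :: real
  assumes pos: "a > 0" "b > 0"
    and summ: "\<And>d. l2 d \<Longrightarrow> summable (\<lambda>n. d n *\<^sub>C e (Suc n))"
    and lower: "\<And>d. l2 d \<Longrightarrow> l2norm d \<le> a * norm (\<Sum>n. d n *\<^sub>C e (Suc n))"
    and upper: "\<And>d. l2 d \<Longrightarrow> norm (\<Sum>n. d n *\<^sub>C e (Suc n)) \<le> b * l2norm d"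

lemma riesz_basis_bounds:
  fixes e :: "nat \<Rightarrow> 'h::complex_hilbert"
  assumes "riesz_basis e"
  shows "\<exists>a b. riesz_bounds e a b"
proof -
  from assms obtain u S where u: "orthonormal_basis u" and S: "bounded_clinear S" "bij S"
    "bounded_clinear (inv S)" and e: "\<And>n. n \<ge> 1 \<Longrightarrow> e n = S (u n)"
    unfolding riesz_basis_def by blast
  define v where "v = (\<lambda>n. u (Suc n))"
  have v: "cinner (v m) (v n) = (if m = n then 1 else 0)" for m n
    using u by (auto simp: orthonormal_basis_def v_def)
  have bl: "bounded_linear S" "bounded_linear (inv S)" using S by (auto simp: bounded_clinear_def)
  obtain b where b: "b > 0" "\<And>x. norm (S x) \<le> norm x * b" using bounded_linear.pos_bounded[OF bl(1)] by blast
  obtain a where a: "a > 0" "\<And>x. norm (inv S x) \<le> norm x * a" using bounded_linear.pos_bounded[OF bl(2)] by blast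
  have eq: "(\<lambda>n. d n *\<^sub>C e (Suc n)) = (\<lambda>n. S (d n *\<^sub>C v n))" for d
    using S(1) by (auto simp: e v_def bounded_clinear_def)
  have "summable (\<lambda>n. d n *\<^sub>C e (Suc n)) \<and> l2norm d \<le> a * norm (\<Sum>n. d n *\<^sub>C e (Suc n)) \<and>
     norm (\<Sum>n. d n *\<^sub>C e (Suc n)) \<le> b * l2norm d" if d: "l2 d" for d
  proof -
    note o = orthonormal_series[of v d, OF v d]
    have s: "(\<Sum>n. d n *\<^sub>C e (Suc n)) = S (\<Sum>n. d n *\<^sub>C v n)"
      unfolding eq by (rule bounded_linear.suminf[OF bl(1) o(1), symmetric])
    have "summable (\<lambda>n. d n *\<^sub>C e (Suc n))"
      unfolding eq by (rule bounded_linear.summable[OF bl(1) o(1)])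
    moreover have "inv S (S y) = y" for y using S(2) by (simp add: bij_is_inj)
    ultimately show ?thesis
      using a(2)[of "S (\<Sum>n. d n *\<^sub>C v n)"] b(2)[of "\<Sum>n. d n *\<^sub>C v n"] o(2) s by (simp add: mult.commute)
  qed
  thus ?thesis using a(1) b(1) unfolding riesz_bounds_def by blast
qed

section \<open>Translation of \<open>bdiff\<close> into \<open>nabla\<close> and \<open>fwd\<close>,
  and the coordinates of H_k\<close>

lemma bdiff_Suc:
  fixes u :: "nat \<Rightarrow> 'a::comm_ring_1"
  shows "bdiff (Suc k) u n = bdiff k u n - bdiff k u (n - 1)"
proof -
  \<comment> \<open>The zero-extended values u(n - j). Pascal's rule then splits the sum; for n = 0
    every guarded value is 0, so truncated subtraction does no harm.\<close>
  define w where "w = (\<lambda>j. if j < n then u (n - j) else 0)"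
  have w: "(if j < n - 1 then u (n - 1 - j) else 0) = w (Suc j)" for j by (auto simp: w_def)
  have shift: "(\<Sum>j\<le>Suc k. (- 1) ^ j * of_nat (k choose j) * w j) =
      w 0 + (\<Sum>j\<le>k. (- 1) ^ Suc j * of_nat (k choose Suc j) * w (Suc j))"
    by (subst sum.atMost_Suc_shift) simp
  have "bdiff (Suc k) u n = (\<Sum>j\<le>Suc k. (- 1) ^ j * of_nat (Suc k choose j) * w j)"
    by (simp add: bdiff_def w_def)
  also have "\<dots> = w 0 + (\<Sum>j\<le>k. (- 1) ^ Suc j * of_nat (Suc k choose Suc j) * w (Suc j))"
    by (subst sum.atMost_Suc_shift) simp
  also have "(\<Sum>j\<le>k. (- 1) ^ Suc j * of_nat (Suc k choose Suc j) * w (Suc j)) =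
     (\<Sum>j\<le>k. (- 1) ^ Suc j * of_nat (k choose Suc j) * w (Suc j)) -
     (\<Sum>j\<le>k. (- 1) ^ j * of_nat (k choose j) * w (Suc j))"
    unfolding sum_subtractf[symmetric] by (intro sum.cong) (auto simp: algebra_simps)
  also have "w 0 + \<dots> = (\<Sum>j\<le>Suc k. (- 1) ^ j * of_nat (k choose j) * w j) -
     (\<Sum>j\<le>k. (- 1) ^ j * of_nat (k choose j) * w (Suc j))"
    by (simp only: shift add_diff_eq)
  also have "\<dots> = bdiff k u n - bdiff k u (n - 1)"
    unfolding bdiff_def w by (simp add: w_def binomial_eq_0)
  finally show ?thesis .
qed

text \<open>Zero extension to nonpositive indices is the boundary convention built into
  \<open>nabla\<close>.\<close>

lemma bdiff_eq_nabla: "bdiff k c (Suc n) = (nabla ^^ k) (\<lambda>n. c (Suc n)) n"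
proof (induction k arbitrary: n)
  case (Suc k)
  have "bdiff k c 0 = 0" by (simp add: bdiff_def)
  thus ?case by (cases n) (auto simp: bdiff_Suc Suc nabla_def)
qed (simp add: bdiff_def)

text \<open>At index n + k + 1 the backward window contains only positive indices, so the difference
  is a forward one based at n + 1.\<close>

lemma bdiff_eq_fwd: "bdiff k f (Suc (n + k)) = (fwd ^^ k) (\<lambda>n. f (Suc n)) n"
proof (induction k arbitrary: n)
  case (Suc k)
  show ?case using Suc[of n] Suc[of "Suc n"] by (simp add: bdiff_Suc fwd_def)
qed (simp add: bdiff_def)

text \<open>Passing from backward to forward differences moves the index by j, and the weight at the
  later index is the larger one.\<close>

lemma S_class_fwd:
  assumes "f \<in> S_class k" "j \<in> {1..k}"
  shows "Bseq (\<lambda>n. real (Suc n) ^ j * (fwd ^^ j) (\<lambda>n. f (Suc n)) n)"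
proof -
  obtain K where K: "\<And>n. norm (real n ^ j * bdiff j f n) \<le> K"
    using assms unfolding S_class_def Bseq_def by blast
  have "norm (real (Suc n) ^ j * (fwd ^^ j) (\<lambda>n. f (Suc n)) n) \<le> K" for n
  proof -
    have "norm (real (Suc n) ^ j * (fwd ^^ j) (\<lambda>n. f (Suc n)) n) \<le>
        norm (real (Suc (n + j)) ^ j * bdiff j f (Suc (n + j)))"
      unfolding bdiff_eq_fwd norm_mult by (intro mult_right_mono) (auto intro!: power_mono)
    thus ?thesis using K order_trans by blast
  qed
  thus ?thesis by (rule BseqI')
qed

text \<open>The sequence of k-th differences of c, reindexed from 0; it identifies
  \<open>l2_Delta k\<close> with l2.\<close>

definition coeff_diff :: "nat \<Rightarrow> (nat \<Rightarrow> complex) \<Rightarrow> nat \<Rightarrow> complex" where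
  "coeff_diff k c = (nabla ^^ k) (\<lambda>n. c (Suc n))"

lemma l2_Delta_iff: "c \<in> l2_Delta k \<longleftrightarrow> c 0 = 0 \<and> l2 (coeff_diff k c)"
  unfolding l2_Delta_def l2_def coeff_diff_def bdiff_eq_nabla[symmetric]
  using summable_Suc_iff[of "\<lambda>n. (cmod (bdiff k c n))\<^sup>2"] by simp

lemma Hk_norm_eq: "Hk_norm k e c = norm (\<Sum>n. coeff_diff k c n *\<^sub>C e (Suc n))"
  by (simp add: Hk_norm_def bdiff_eq_nabla coeff_diff_def)

lemma Hk_norm_nonneg [simp]: "Hk_norm k e c \<ge> 0"
  by (simp add: Hk_norm_def)

lemma coeff_diff_add: "coeff_diff k (x + y) = (\<lambda>n. coeff_diff k x n + coeff_diff k y n)"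
  by (simp add: coeff_diff_def nabla_pow_add)

lemma coeff_diff_scale: "coeff_diff k (a *\<^sub>C x) = (\<lambda>n. a * coeff_diff k x n)"
  by (simp add: coeff_diff_def nabla_pow_scale scaleC_fun_def scaleC_complex_def)

lemma coeff_diff_diff: "coeff_diff k (x - y) = (\<lambda>n. coeff_diff k x n - coeff_diff k y n)"
  using coeff_diff_add[of k x "(-1) *\<^sub>C y"] coeff_diff_scale[of k "-1" y]
  by (simp add: complex_vector.scale_minus_left)

lemma l2_Delta_add: "x \<in> l2_Delta k \<Longrightarrow> y \<in> l2_Delta k \<Longrightarrow> x + y \<in> l2_Delta k"
  by (simp add: l2_Delta_iff coeff_diff_add l2norm_triangle)

lemma l2_Delta_scale: "x \<in> l2_Delta k \<Longrightarrow> a *\<^sub>C x \<in> l2_Delta k"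
  by (auto simp: l2_Delta_iff coeff_diff_scale l2_scale) (simp add: scaleC_fun_def scaleC_complex_def)

lemma l2_Delta_diff: "x \<in> l2_Delta k \<Longrightarrow> y \<in> l2_Delta k \<Longrightarrow> x - y \<in> l2_Delta k"
  by (simp add: l2_Delta_iff coeff_diff_diff l2_diff)

text \<open>Hardy's inequality makes coordinates continuous on H_k. This gives definiteness of the
  norm and, later, coordinatewise limits of difference quotients.\<close>

lemma coordinate_bound:
  assumes "c \<in> l2_Delta k"
  shows "cmod (c (Suc n)) \<le> real (Suc n) ^ k * 2 ^ k * l2norm (coeff_diff k c)"
proof -
  have l: "l2 ((nabla ^^ k) (\<lambda>n. c (Suc n)))" using assms by (simp add: l2_Delta_iff coeff_diff_def)
  have "cmod (c (Suc n) / of_nat (Suc n) ^ k) \<le> 2 ^ k * l2norm (coeff_diff k c)"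
    using cmod_le_l2norm[OF hardy(1)[OF l], of n] hardy(2)[OF l] unfolding coeff_diff_def by linarith
  thus ?thesis by (simp add: norm_divide norm_power divide_le_eq mult_ac del: of_nat_Suc)
qed

section \<open>The Banach space structure of H_k\<close>

context riesz_bounds
begin

lemma Hk_lower: "c \<in> l2_Delta k \<Longrightarrow> l2norm (coeff_diff k c) \<le> a * Hk_norm k e c"
  using lower by (simp add: l2_Delta_iff Hk_norm_eq)

lemma Hk_upper: "c \<in> l2_Delta k \<Longrightarrow> Hk_norm k e c \<le> b * l2norm (coeff_diff k c)"
  using upper by (simp add: l2_Delta_iff Hk_norm_eq)

lemma Hk_tendsto_0_iff:
  assumes "\<forall>\<^sub>F t in F. c t \<in> l2_Delta k"
  shows "((\<lambda>t. Hk_norm k e (c t)) \<longlongrightarrow> 0) F \<longleftrightarrow> ((\<lambda>t. l2norm (coeff_diff k (c t))) \<longlongrightarrow> 0) F"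
proof
  assume *: "((\<lambda>t. Hk_norm k e (c t)) \<longlongrightarrow> 0) F"
  show "((\<lambda>t. l2norm (coeff_diff k (c t))) \<longlongrightarrow> 0) F"
  proof (rule tendsto_sandwich[OF _ _ tendsto_const])
    show "((\<lambda>t. a * Hk_norm k e (c t)) \<longlongrightarrow> 0) F" using tendsto_mult_right_zero[OF *] .
  qed (use assms in \<open>auto elim!: eventually_mono simp: Hk_lower l2_Delta_iff\<close>)
next
  assume *: "((\<lambda>t. l2norm (coeff_diff k (c t))) \<longlongrightarrow> 0) F"
  show "((\<lambda>t. Hk_norm k e (c t)) \<longlongrightarrow> 0) F"
  proof (rule tendsto_sandwich[OF _ _ tendsto_const])
    show "((\<lambda>t. b * l2norm (coeff_diff k (c t))) \<longlongrightarrow> 0) F" using tendsto_mult_right_zero[OF *] .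
  qed (use assms in \<open>auto elim!: eventually_mono simp: Hk_upper\<close>)
qed

lemma Hk_zero_iff:
  assumes "c \<in> l2_Delta k"
  shows "Hk_norm k e c = 0 \<longleftrightarrow> c = 0"
proof
  assume "Hk_norm k e c = 0"
  hence "l2norm (coeff_diff k c) \<le> 0" using Hk_lower[OF assms] by simp
  hence "real (Suc n) ^ k * 2 ^ k * l2norm (coeff_diff k c) \<le> 0" for n
    by (intro mult_nonneg_nonpos) auto
  hence "c (Suc n) = 0" for n using coordinate_bound[OF assms, of n] by (metis norm_le_zero_iff order_trans)
  thus "c = 0" using assms by (auto simp: fun_eq_iff l2_Delta_iff) (metis not0_implies_Suc)
next
  have "coeff_diff k 0 = (\<lambda>n. 0)" using coeff_diff_scale[of k 0 0] by simp
  thus "c = 0 \<Longrightarrow> Hk_norm k e c = 0" by (simp add: Hk_norm_eq)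
qed

text \<open>Completeness is transported from l2: the differences converge there, and surjectivity of
  \<open>nabla ^^ k\<close> lifts their limit.\<close>

lemma Hk_complete:
  assumes s: "range s \<subseteq> l2_Delta k"
    and Cauchy: "\<forall>\<epsilon>>0. \<exists>M. \<forall>m\<ge>M. \<forall>n\<ge>M. Hk_norm k e (s m - s n) < \<epsilon>"
  shows "\<exists>x\<in>l2_Delta k. (\<lambda>n. Hk_norm k e (s n - x)) \<longlonglongrightarrow> 0"
proof -
  have s': "s m \<in> l2_Delta k" for m using s by auto
  have "\<exists>M. \<forall>m\<ge>M. \<forall>n\<ge>M. l2norm (\<lambda>i. coeff_diff k (s m) i - coeff_diff k (s n) i) < \<epsilon>" if "\<epsilon> > 0" for \<epsilon>
  proof -
    have "\<epsilon> / a > 0" using that pos by simp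
    then obtain M where M: "\<forall>m\<ge>M. \<forall>n\<ge>M. Hk_norm k e (s m - s n) < \<epsilon> / a" using Cauchy by blast
    have "l2norm (\<lambda>i. coeff_diff k (s m) i - coeff_diff k (s n) i) < \<epsilon>" if "m \<ge> M" "n \<ge> M" for m n
    proof -
      have "a * Hk_norm k e (s m - s n) < \<epsilon>"
        using M that pos by (metis mult.commute pos_less_divide_eq)
      thus ?thesis using Hk_lower[OF l2_Delta_diff[OF s' s'], of m n] by (simp add: coeff_diff_diff)
    qed
    thus ?thesis by blast
  qed
  from l2_complete[OF _ this] obtain d where d: "l2 d"
    "(\<lambda>m. l2norm (\<lambda>i. coeff_diff k (s m) i - d i)) \<longlonglongrightarrow> 0"
    using s' by (auto simp: l2_Delta_iff)
  obtain y where y: "(nabla ^^ k) y = d" using nabla_pow_surj by blast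
  \<comment> \<open>Index 0 receives the value 0 demanded by \<open>l2_Delta\<close>.\<close>
  define x where "x = (\<lambda>n. if n = 0 then 0 else y (n - 1))"
  have cx: "coeff_diff k x = d" by (simp add: coeff_diff_def x_def y)
  have x: "x \<in> l2_Delta k" using d(1) by (simp add: l2_Delta_iff cx) (simp add: x_def)
  have "(\<lambda>n. Hk_norm k e (s n - x)) \<longlonglongrightarrow> 0"
    using d(2) by (subst Hk_tendsto_0_iff) (auto simp: coeff_diff_diff cx l2_Delta_diff s' x)
  with x show ?thesis by blast
qed

lemma Hk_banach: "complex_banach_on (l2_Delta k) (Hk_norm k e)"
  unfolding complex_banach_on_def
proof (intro conjI ballI allI impI)
  show "csubspace (l2_Delta k)"
    unfolding complex_vector.subspace_def
    using l2_Delta_add l2_Delta_scale coeff_diff_scale[of k 0 0] by (auto simp: l2_Delta_iff l2_def)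
  show "Hk_norm k e x \<ge> 0" for x by simp
  show "Hk_norm k e x = 0 \<longleftrightarrow> x = 0" if "x \<in> l2_Delta k" for x using Hk_zero_iff that .
  show "Hk_norm k e (z *\<^sub>C x) = cmod z * Hk_norm k e x" if "x \<in> l2_Delta k" for z x
  proof -
    have bl: "bounded_linear (\<lambda>h::'h. z *\<^sub>C h)"
      by (rule bounded_linear_intro[where K="cmod z"])
         (auto simp: scaleC_add_right scaleR_scaleC scaleC_scaleC norm_scaleC mult.commute)
    have "(\<Sum>n. coeff_diff k (z *\<^sub>C x) n *\<^sub>C e (Suc n)) = z *\<^sub>C (\<Sum>n. coeff_diff k x n *\<^sub>C e (Suc n))"
      using bounded_linear.suminf[OF bl summ] that by (simp add: l2_Delta_iff coeff_diff_scale scaleC_scaleC)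
    thus ?thesis by (simp add: Hk_norm_eq norm_scaleC)
  qed
  show "Hk_norm k e (x + y) \<le> Hk_norm k e x + Hk_norm k e y" if "x \<in> l2_Delta k" "y \<in> l2_Delta k" for x y
  proof -
    let ?s = "\<lambda>x. \<Sum>n. coeff_diff k x n *\<^sub>C e (Suc n)"
    have "?s (x + y) = ?s x + ?s y"
      using suminf_add[OF summ summ, of "coeff_diff k x" "coeff_diff k y"] that
      by (simp add: l2_Delta_iff coeff_diff_add scaleC_add_left)
    thus ?thesis by (simp add: Hk_norm_eq norm_triangle_ineq)
  qed
qed (use Hk_complete in auto)

end

section \<open>The group and its generator\<close>

theorem theorem10:
  fixes e :: "nat \<Rightarrow> 'h::complex_hilbert"
    and k :: nat
    and f :: "nat \<Rightarrow> real"
  assumes "separable_space (euclidean :: 'h topology)"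
    and "\<not> (\<exists>B :: 'h set. finite B \<and> cspan B = UNIV)"
    and "riesz_basis e"
    and "k \<ge> 1"
    and "f \<in> S_class k"
  shows "\<exists>U. generates_C0_group_on (l2_Delta k) (Hk_norm k e) (A_dom k f) (A_op f) U \<and>
             (\<forall>t. \<forall>c\<in>l2_Delta k. U t c = (\<lambda>n. exp (\<i> * complex_of_real (t * f n)) * c n))"
proof -
  obtain a b where "riesz_bounds e a b"
    using riesz_basis_bounds[OF \<open>riesz_basis e\<close>] by blast
  then interpret riesz_bounds e a b .
  let ?X = "l2_Delta k" and ?N = "Hk_norm k e"
  \<comment> \<open>Reindexing from 0 discards the irrelevant value \<open>f 0\<close>.\<close>
  define g where "g = (\<lambda>n. f (Suc n))"
  define U where "U = (\<lambda>t c n. cis (t * f n) * c n)"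
  have Bs: "\<forall>j\<in>{1..k}. Bseq (\<lambda>n. real (Suc n) ^ j * (fwd ^^ j) g n)"
    using S_class_fwd[OF assms(5)] by (simp add: g_def)
  have cdU: "coeff_diff k (U t c) = (nabla ^^ k) (\<lambda>n. cis (t * g n) * c (Suc n))" for t c
    by (simp add: coeff_diff_def U_def g_def)
  have U: "U t c \<in> ?X \<and> (\<exists>C. \<forall>c\<in>?X. ?N (U t c) \<le> C * ?N c)" if "c \<in> ?X" for t c
  proof -
    obtain C where C: "symbol k 0 C (\<lambda>n. cis (t * g n))" using cis_symbol_bound[OF Bs, of "\<bar>t\<bar>"] by blast
    have m: "l2 (coeff_diff k (U t c)) \<and> l2norm (coeff_diff k (U t c)) \<le> C * 3 ^ k * l2norm (coeff_diff k c)"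
      if "c \<in> ?X" for c
      using symbol_multiplier[OF C, of "\<lambda>n. c (Suc n)"] that unfolding cdU by (simp add: l2_Delta_iff coeff_diff_def)
    have UX: "U t c \<in> ?X" if "c \<in> ?X" for c using m[OF that] that by (simp add: l2_Delta_iff U_def)
    \<comment> \<open>The three factors come from the upper Riesz bound, the multiplier bound with r
      = 0, and the lower Riesz bound.\<close>
    have "?N (U t c) \<le> (b * (C * 3 ^ k) * a) * ?N c" if "c \<in> ?X" for c
    proof -
      have "?N (U t c) \<le> b * l2norm (coeff_diff k (U t c))" using Hk_upper[OF UX[OF that]] .
      also have "\<dots> \<le> b * (C * 3 ^ k * (a * ?N c))"
        using pos symbol_nonneg[OF C] m[OF that] Hk_lower[OF that]
        by (intro mult_left_mono order_trans[OF conjunct2[OF m[OF that]]]) auto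
      finally show ?thesis by (simp add: mult_ac)
    qed
    with UX[OF that] show ?thesis by blast
  qed
  have UX: "U t c \<in> ?X" if "c \<in> ?X" for t c using U[OF that] by blast
  \<comment> \<open>One constant for all times in [-1, 1] suffices for the limits at t = 0
    below.\<close>
  obtain C where C: "\<And>t. \<bar>t\<bar> \<le> 1 \<Longrightarrow> symbol k 0 C (\<lambda>n. cis (t * g n))" using cis_symbol_bound[OF Bs, of 1] by blast
  have C1: "symbol k 0 (C + 1) (\<lambda>n. cis (t * g n) - 1)" if "\<bar>t\<bar> \<le> 1" for t
    by (rule symbol_cis_minus_1[OF C[OF that]])
  have near0: "\<forall>\<^sub>F t in at (0::real). \<bar>t\<bar> \<le> 1 \<and> t \<noteq> 0"
    unfolding eventually_at by (intro exI[of _ 1]) auto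
  have add: "U (s + t) c = U s (U t c)" for s t c
    by (auto simp: U_def cis_mult[symmetric] distrib_right)
  have Ulin: "U t (c + d) = U t c + U t d" "U t (c - d) = U t c - U t d" "U t (z *\<^sub>C c) = z *\<^sub>C U t c" for t c d z
    by (auto simp: U_def fun_eq_iff algebra_simps scaleC_fun_def scaleC_complex_def)
  have cont0: "((\<lambda>t. ?N (U t c - c)) \<longlongrightarrow> 0) (at 0)" if c: "c \<in> ?X" for c
  proof -
    have "((\<lambda>t. l2norm ((nabla ^^ k) (\<lambda>n. (cis (t * g n) - 1) * c (Suc n)))) \<longlongrightarrow> 0) (at 0)"
    proof (rule symbol_multiplier_tendsto_0[where r=0])
      show "\<forall>\<^sub>F t in at 0. symbol k 0 (C + 1) (\<lambda>n. cis (t * g n) - 1)"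
        using near0 by eventually_elim (use C1 in auto)
      show "((\<lambda>t. cis (t * g n) - 1) \<longlongrightarrow> 0) (at 0)" for n
        by (auto intro!: tendsto_eq_intros simp: cis_conv_exp)
    qed (use c in \<open>auto simp: l2_Delta_iff coeff_diff_def\<close>)
    also have "(\<lambda>t. (nabla ^^ k) (\<lambda>n. (cis (t * g n) - 1) * c (Suc n))) = (\<lambda>t. coeff_diff k (U t c - c))"
      by (simp add: coeff_diff_def U_def g_def left_diff_distrib)
    finally show ?thesis by (subst Hk_tendsto_0_iff) (auto intro!: always_eventually l2_Delta_diff UX c)
  qed
  have cont: "((\<lambda>t. ?N (U t c - U t0 c)) \<longlongrightarrow> 0) (at t0)" if c: "c \<in> ?X" for c t0
  proof -
    \<comment> \<open>Continuity at t0 follows from continuity at 0 by the group law and boundedness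
      of \<open>U t0\<close>.\<close>
    obtain K where K: "\<And>d. d \<in> ?X \<Longrightarrow> ?N (U t0 d) \<le> K * ?N d" using U[OF c, of t0] by blast
    have le: "?N (U (t0 + h) c - U t0 c) \<le> K * ?N (U h c - c)" for h
      using K[OF l2_Delta_diff[OF UX[OF c, of h] c]] unfolding add Ulin .
    have "((\<lambda>h. ?N (U (t0 + h) c - U t0 c)) \<longlongrightarrow> 0) (at 0)"
    proof (rule tendsto_sandwich[OF _ _ tendsto_const])
      show "((\<lambda>h. K * ?N (U h c - c)) \<longlongrightarrow> 0) (at 0)" using tendsto_mult_right_zero[OF cont0[OF c]] .
    qed (intro always_eventually allI le Hk_norm_nonneg)+
    thus ?thesis by (rule LIM_offset_zero_cancel)
  qed
  have group: "C0_group_on ?X ?N U"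
    unfolding C0_group_on_def bounded_operator_on_def
  proof (intro conjI allI ballI)
    \<comment> \<open>The operator bound in \<open>U\<close> is stated for a given element of the
      space; 0 supplies one.\<close>
    have "0 \<in> ?X" using Hk_banach[of k] by (simp add: complex_banach_on_def complex_vector.subspace_0)
    thus "\<exists>C. \<forall>x\<in>?X. ?N (U t x) \<le> C * ?N x" for t using U[of 0 t] by blast
    show "U t ` ?X \<subseteq> ?X" for t using UX by blast
    show "U 0 x = x" for x by (simp add: U_def)
    show "((\<lambda>t. ?N (U t x - U t0 x)) \<longlongrightarrow> 0) (at t0)" if "x \<in> ?X" for x t0 by (rule cont[OF that])
  qed (rule Hk_banach Ulin add)+
  have deriv: "A_op f c \<in> ?X \<and> has_orbit_derivative ?N U c (A_op f c)" if c: "c \<in> A_dom k f" for c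
  proof -
    \<comment> \<open>By the domain condition this sequence lies in the space, so the normalised
      remainder multiplier tends to 0 on it.\<close>
    define d where "d = (\<lambda>n. complex_of_real (f n) * c n)"
    have cX: "c \<in> ?X" and d: "d \<in> ?X" using c by (auto simp: A_dom_def d_def)
    have A: "A_op f c = \<i> *\<^sub>C d" by (auto simp: A_op_def d_def scaleC_fun_def scaleC_complex_def)
    hence AX: "A_op f c \<in> ?X" using l2_Delta_scale[OF d] by simp
    let ?m = "\<lambda>t n. complex_of_real (1 / t) * cis_rem g t n"
    have "((\<lambda>t. l2norm ((nabla ^^ k) (\<lambda>n. ?m t n * d (Suc n)))) \<longlongrightarrow> 0) (at 0)"
    proof (rule symbol_multiplier_tendsto_0[where r=0])
      show "\<forall>\<^sub>F t in at 0. symbol k 0 (C + 1) (?m t)"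
        using near0 by eventually_elim (use symbol_cis_rem[OF C1] in auto)
      show "((\<lambda>t. ?m t n) \<longlongrightarrow> 0) (at 0)" for n by (rule cis_rem_tendsto_0)
    qed (use d in \<open>auto simp: l2_Delta_iff coeff_diff_def\<close>)
    moreover have "\<forall>\<^sub>F t in at 0. (nabla ^^ k) (\<lambda>n. ?m t n * d (Suc n)) =
        coeff_diff k (complex_of_real (1 / t) *\<^sub>C (U t c - c) - A_op f c)"
      using near0
    proof eventually_elim
      case (elim t)
      have "(\<lambda>n. ?m t n * d (Suc n)) = (\<lambda>n. (complex_of_real (1 / t) *\<^sub>C (U t c - c) - A_op f c) (Suc n))"
        using cis_rem_mult[of t g _ "c (Suc _)"] elim
        by (auto simp: d_def g_def U_def A_op_def scaleC_fun_def scaleC_complex_def)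
      thus ?case by (simp add: coeff_diff_def)
    qed
    ultimately have "((\<lambda>t. l2norm (coeff_diff k (complex_of_real (1 / t) *\<^sub>C (U t c - c) - A_op f c))) \<longlongrightarrow> 0) (at 0)"
      by (rule Lim_transform_eventually[OF _ eventually_mono]) simp
    hence "has_orbit_derivative ?N U c (A_op f c)"
      unfolding has_orbit_derivative_def
      by (subst Hk_tendsto_0_iff) (auto intro!: always_eventually l2_Delta_diff l2_Delta_scale UX cX AX)
    with AX show ?thesis by blast
  qed
  have dom: "c \<in> A_dom k f" if c: "c \<in> ?X" and y: "y \<in> ?X" and D: "has_orbit_derivative ?N U c y" for c y
  proof -
    define q where "q = (\<lambda>t. complex_of_real (1 / t) *\<^sub>C (U t c - c) - y)"
    have q: "q t \<in> ?X" for t unfolding q_def by (intro l2_Delta_diff l2_Delta_scale UX c y)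
    have lim: "((\<lambda>t. l2norm (coeff_diff k (q t))) \<longlongrightarrow> 0) (at 0)"
      using D Hk_tendsto_0_iff[of q k "at 0"] q unfolding has_orbit_derivative_def q_def by auto
    \<comment> \<open>Norm convergence forces coordinatewise convergence, which identifies y as the
      formal image of c.\<close>
    have "y (Suc n) = \<i> * complex_of_real (g n) * c (Suc n)" for n
    proof -
      have "((\<lambda>t. q t (Suc n)) \<longlongrightarrow> 0) (at 0)"
        by (rule Lim_null_comparison[OF always_eventually tendsto_mult_right_zero[OF lim]])
           (use coordinate_bound[OF q] in auto)
      moreover have "((\<lambda>t. complex_of_real (1 / t) * cis_rem g t n * (complex_of_real (g n) * c (Suc n)))
          \<longlongrightarrow> 0) (at 0)"
        by (rule tendsto_mult_left_zero[OF cis_rem_tendsto_0])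
      ultimately have "((\<lambda>t. complex_of_real (1 / t) * cis_rem g t n * (complex_of_real (g n) * c (Suc n))
          - q t (Suc n)) \<longlongrightarrow> 0 - 0) (at 0)"
        by (intro tendsto_diff)
      \<comment> \<open>The difference quotient cancels between the two expressions. What remains is
        constant in t and tends to 0, hence is 0.\<close>
      moreover have "\<forall>\<^sub>F t in at 0. complex_of_real (1 / t) * cis_rem g t n * (complex_of_real (g n) * c (Suc n))
          - q t (Suc n) = y (Suc n) - \<i> * complex_of_real (g n) * c (Suc n)"
        using near0
        by eventually_elim
          (subst cis_rem_mult, auto simp: q_def U_def g_def scaleC_fun_def scaleC_complex_def)
      ultimately have "((\<lambda>t::real. y (Suc n) - \<i> * complex_of_real (g n) * c (Suc n)) \<longlongrightarrow> 0) (at 0)"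
        using Lim_transform_eventually by fastforce
      thus ?thesis by (simp add: tendsto_const_iff)
    qed
    hence "y n = \<i> * complex_of_real (f n) * c n" for n
      using c y by (cases n) (auto simp: l2_Delta_iff g_def)
    \<comment> \<open>Since f c = -i y and y lies in the space, c satisfies the domain
      condition.\<close>
    hence "(\<lambda>n. complex_of_real (f n) * c n) = (- \<i>) *\<^sub>C y"
      by (auto simp: scaleC_fun_def scaleC_complex_def mult.assoc[symmetric])
    thus ?thesis using c l2_Delta_scale[OF y, of "-\<i>"] by (simp add: A_dom_def)
  qed
  have "generates_C0_group_on ?X ?N (A_dom k f) (A_op f) U"
    unfolding generates_C0_group_on_def using group deriv dom by (auto simp: A_dom_def)
  thus ?thesis
    by (intro exI[of _ U]) (auto simp: U_def cis_conv_exp)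
qed

end
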